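(* Let $\Gamma\subset\mathbb{R}^n$ be the attractor of an iterated function system $\{s_1,\dots,s_M\}$ of contracting similarities satisfying the open set condition, and let $\mu$ be an invariant measure on $\Gamma$ with weights $(p_1,\dots,p_M)$. Fix $m\in\{1,\dots,M\}$, let $\eta_m\in\Gamma$ be the fixed point of $s_m$, suppose that $\eta_m\notin\Gamma_{m'}$ for every $m'\in\{1,\dots,M\}$ with $m'\neq m$, and let $t_m:=\log p_m/\log\rho_m$. Let $0<h<\mathrm{diam}(\Gamma)$, and suppose that $\eta_m\notin\mathrm{Hull}(\Gamma_{\boldsymbol m'})$ for each $\boldsymbol m'=(m_1',\ldots)\in L_h(\Gamma)$ such that $m_1'\ne m$. Then the quadrature rule $Q^h_{\Gamma,t,m}$ (defined in the context) for the integral $I_\Gamma[\Phi_t(\cdot,\eta_m)]=\int_\Gamma\Phi_t(x,\eta_m)\,d\mu(x)$ satisfies $$\big|I_\Gamma[\Phi_t(\cdot,\eta_m)]-Q^h_{\Gamma,t,m}\big|\le\frac{n\,a_t\,h^2\mu(\Gamma)}{2(1-p_m\rho_m^{-t})R_{m,h}^{t+2}},\qquad0\le t<t_m,$$ where $$R_{m,h}:=\min_{\boldsymbol m'\in L_h(\Gamma),\,m_1'\ne m}\mathrm{dist}\big(\eta_m,\mathrm{Hull}(\Gamma_{\boldsymbol m'})\big)>0,$$ and $a_0:=2$, $a_t:=t(t+2)$ for $t>0$.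
   Context: IFS: a collection $\{s_1,\dots,s_M\}$, $M\ge2$, of maps $s_m:\mathbb{R}^n\to\mathbb{R}^n$, $s_m(x)=\rho_mA_mx+\delta_m$, with $\rho_m\in(0,1)$, $A_m$ an orthogonal $n\times n$ matrix, $\delta_m\in\mathbb{R}^n$. Its attractor $\Gamma$ is the unique non-empty compact set with $\Gamma=\bigcup_{m=1}^Ms_m(\Gamma)$. Open set condition: there is a non-empty bounded open set $O\subset\mathbb{R}^n$ with $\bigcup_ms_m(O)\subset O$ and $s_m(O)\cap s_{m'}(O)=\emptyset$ for $m\ne m'$. Invariant measure with weights $(p_1,\dots,p_M)$, where $p_m\in(0,1)$ and $\sum_mp_m=1$: a non-zero finite Borel regular measure $\mu$ supported on $\Gamma$ such that $\mu(A)=\sum_{m=1}^Mp_m\mu(s_m^{-1}(A))$ for every measurable $A\subset\mathbb{R}^n$. Vector indices: $I_\ell:=\{1,\dots,M\}^\ell$ for $\ell\in\mathbb{N}=\{1,2,\ldots\}$; for $\boldsymbol m=(m_1,\dots,m_\ell)\in I_\ell$, $\Gamma_{\boldsymbol m}:=s_{m_1}\circ\dots\circ s_{m_\ell}(\Gamma)$; $\Gamma_0:=\Gamma$. For $0<h<\mathrm{diam}(\Gamma)$, $L_h(\Gamma)$ is the set of all $\boldsymbol m=(m_1,\dots,m_\ell)\in\bigcup_{\ell'\in\mathbb{N}}I_{\ell'}$ with $\mathrm{diam}(\Gamma_{\boldsymbol m})\le h$ and $\mathrm{diam}(\Gamma_{(m_1,\dots,m_{\ell-1})})>h$ (with $\Gamma_{(m_1,\dots,m_{\ell-1})}$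 replaced by $\Gamma$ if $\ell=1$); $L_h(\Gamma):=\{0\}$ for $h\ge\mathrm{diam}(\Gamma)$. $\mathrm{Hull}$ denotes convex hull. Each $\Gamma_{m'}$, $m'\in\{1,\dots,M\}$, is the attractor of the IFS $\{s_{m'}\circ s_j\circ s_{m'}^{-1}\}_{j=1}^M$; with respect to this IFS, $(\Gamma_{m'})_{\boldsymbol n}=\Gamma_{(m',\boldsymbol n)}$, with $\Gamma_{(m',0)}:=\Gamma_{m'}$. For $0<h<\mathrm{diam}(\Gamma_{m'})$, $L_h(\Gamma_{m'})$ is the set of all $\boldsymbol n=(n_1,\dots,n_\ell)\in\bigcup_{\ell'\in\mathbb{N}}I_{\ell'}$ with $\mathrm{diam}(\Gamma_{(m',\boldsymbol n)})\le h$ and $\mathrm{diam}(\Gamma_{(m',n_1,\dots,n_{\ell-1})})>h$ (with $\Gamma_{(m',n_1,\dots,n_{\ell-1})}$ replaced by $\Gamma_{m'}$ if $\ell=1$); $L_h(\Gamma_{m'}):=\{0\}$ for $h\ge\mathrm{diam}(\Gamma_{m'})$. The barycentre rule on $\Gamma_{m'}$ is $Q^h_{\Gamma_{m'}}[f]:=\sum_{\boldsymbol n\in L_h(\Gamma_{m'})}\mu(\Gamma_{(m',\boldsymbol n)})f(x_{(m',\boldsymbol n)})$, where $x_{\boldsymbol k}:=\int_{\Gamma_{\boldsymbol k}}x\,d\mu(x)/\mu(\Gamma_{\boldsymbol k})$. For $x\ne y$: $\Phi_0(x,y):=\log|x-y|$ and $\Phi_t(x,y):=|x-y|^{-t}$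 for $t>0$. The quadrature rule is $$Q^h_{\Gamma,t,m}:=\begin{cases}(1-p_m)^{-1}\Big(p_m\mu(\Gamma)\log\rho_m+\sum_{m'=1,\,m'\ne m}^MQ^h_{\Gamma_{m'}}[\Phi_t(\cdot,\eta_m)]\Big),&t=0,\\(1-p_m\rho_m^{-t})^{-1}\sum_{m'=1,\,m'\ne m}^MQ^h_{\Gamma_{m'}}[\Phi_t(\cdot,\eta_m)],&t\in(0,t_m).\end{cases}$$ *)

theory Defs
  imports "HOL-Analysis.Analysis"
begin

text \<open>Maps, ratios and weights are families indexed by \<^typ>\<open>nat\<close>; only the indices
  in \<^term>\<open>{1..M::nat}\<close> matter.\<close>

definition similarity_ifs ::
  "nat \<Rightarrow> (nat \<Rightarrow> real) \<Rightarrow> (nat \<Rightarrow> real^'n \<Rightarrow> real^'n) \<Rightarrow> bool" where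
  "similarity_ifs M \<rho> s \<longleftrightarrow>
     M \<ge> 2 \<and>
     (\<forall>m\<in>{1..M}. 0 < \<rho> m \<and> \<rho> m < 1 \<and>
        (\<exists>(A :: real^'n^'n) \<delta>. orthogonal_matrix A \<and> (\<forall>x. s m x = \<rho> m *\<^sub>R (A *v x) + \<delta>)))"

text \<open>For contracting maps these conditions determine the attractor uniquely (Hutchinson).\<close>

definition is_attractor :: "nat \<Rightarrow> (nat \<Rightarrow> real^'n \<Rightarrow> real^'n) \<Rightarrow> (real^'n) set \<Rightarrow> bool" where
  "is_attractor M s \<Gamma> \<longleftrightarrow> \<Gamma> \<noteq> {} \<and> compact \<Gamma> \<and> \<Gamma> = (\<Union>m\<in>{1..M}. s m ` \<Gamma>)"

definition open_set_condition :: "nat \<Rightarrow> (nat \<Rightarrow> real^'n \<Rightarrow> real^'n) \<Rightarrow> bool" where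
  "open_set_condition M s \<longleftrightarrow>
     (\<exists>U. U \<noteq> {} \<and> bounded U \<and> open U \<and> (\<Union>m\<in>{1..M}. s m ` U) \<subseteq> U \<and>
        (\<forall>m\<in>{1..M}. \<forall>m'\<in>{1..M}. m \<noteq> m' \<longrightarrow> s m ` U \<inter> s m' ` U = {}))"

text \<open>A Borel regular measure is represented by its restriction to the Borel sets, which
  determines it; hence regularity is not a separate condition. Since the attractor is closed,
  being supported on it means that its complement is a null set.\<close>

definition invariant_measure ::
  "nat \<Rightarrow> (nat \<Rightarrow> real^'n \<Rightarrow> real^'n) \<Rightarrow> (nat \<Rightarrow> real) \<Rightarrow> (real^'n) set \<Rightarrow> (real^'n) measure \<Rightarrow> bool" where
  "invariant_measure M s p \<Gamma> \<mu> \<longleftrightarrow>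
     (\<forall>m\<in>{1..M}. 0 < p m \<and> p m < 1) \<and> (\<Sum>m=1..M. p m) = 1 \<and>
     sets \<mu> = sets borel \<and> finite_measure \<mu> \<and> measure \<mu> UNIV \<noteq> 0 \<and>
     measure \<mu> (- \<Gamma>) = 0 \<and>
     (\<forall>A\<in>sets borel. measure \<mu> A = (\<Sum>m=1..M. p m * measure \<mu> (s m -` A)))"

text \<open>Vector indices are lists over \<^term>\<open>{1..M::nat}\<close>. The index 0 is the empty list,
  so that \<open>component s \<Gamma> [] = \<Gamma>\<close>, and the index \<open>(m', \<^bold>n)\<close> is \<open>m' # ns\<close>.\<close>

fun word_map :: "(nat \<Rightarrow> 'a \<Rightarrow> 'a) \<Rightarrow> nat list \<Rightarrow> 'a \<Rightarrow> 'a" where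
  "word_map s [] = id"
| "word_map s (m # ms) = s m \<circ> word_map s ms"

definition component :: "(nat \<Rightarrow> 'a \<Rightarrow> 'a) \<Rightarrow> 'a set \<Rightarrow> nat list \<Rightarrow> 'a set" where
  "component s \<Gamma> ms = word_map s ms ` \<Gamma>"

text \<open>\<open>L_index M s \<Gamma> ks h\<close> is the index set \<open>L_h\<close> of the component \<open>ks\<close> of \<open>\<Gamma>\<close>, its elements
  being taken relative to the prefix \<open>ks\<close>: the prefix \<open>[]\<close> gives \<open>L_h(\<Gamma>)\<close>, and
  \<open>[m']\<close> gives \<open>L_h(\<Gamma>\<^sub>m\<^sub>')\<close>.\<close>

definition L_index ::
  "nat \<Rightarrow> (nat \<Rightarrow> real^'n \<Rightarrow> real^'n) \<Rightarrow> (real^'n) set \<Rightarrow> nat list \<Rightarrow> real \<Rightarrow> nat list set" where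
  "L_index M s \<Gamma> ks h =
     (if h \<ge> diameter (component s \<Gamma> ks) then {[]}
      else {ns. ns \<noteq> [] \<and> set ns \<subseteq> {1..M} \<and>
                diameter (component s \<Gamma> (ks @ ns)) \<le> h \<and>
                diameter (component s \<Gamma> (ks @ butlast ns)) > h})"

definition barycentre ::
  "(nat \<Rightarrow> real^'n \<Rightarrow> real^'n) \<Rightarrow> (real^'n) set \<Rightarrow> (real^'n) measure \<Rightarrow> nat list \<Rightarrow> real^'n" where
  "barycentre s \<Gamma> \<mu> ks =
     (LINT x:component s \<Gamma> ks|\<mu>. x) /\<^sub>R measure \<mu> (component s \<Gamma> ks)"

definition barycentre_rule ::
  "nat \<Rightarrow> (nat \<Rightarrow> real^'n \<Rightarrow> real^'n) \<Rightarrow> (real^'n) set \<Rightarrow> (real^'n) measure \<Rightarrow> nat list \<Rightarrow> real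
     \<Rightarrow> (real^'n \<Rightarrow> real) \<Rightarrow> real" where
  "barycentre_rule M s \<Gamma> \<mu> ks h f =
     (\<Sum>ns\<in>L_index M s \<Gamma> ks h.
        measure \<mu> (component s \<Gamma> (ks @ ns)) * f (barycentre s \<Gamma> \<mu> (ks @ ns)))"

text \<open>Only meant for \<open>t \<ge> 0\<close> and \<open>x \<noteq> y\<close>; on the diagonal the library conventions for
  \<^const>\<open>ln\<close> and \<open>powr\<close> give the value 0.\<close>

definition Phi :: "real \<Rightarrow> 'a::real_normed_vector \<Rightarrow> 'a \<Rightarrow> real" where
  "Phi t x y = (if t = 0 then ln (norm (x - y)) else norm (x - y) powr (- t))"

definition singular_rule ::
  "nat \<Rightarrow> (nat \<Rightarrow> real) \<Rightarrow> (nat \<Rightarrow> real^'n \<Rightarrow> real^'n) \<Rightarrow> (nat \<Rightarrow> real) \<Rightarrow> (real^'n) set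
     \<Rightarrow> (real^'n) measure \<Rightarrow> real \<Rightarrow> real \<Rightarrow> nat \<Rightarrow> real^'n \<Rightarrow> real" where
  "singular_rule M \<rho> s p \<Gamma> \<mu> h t m \<eta> =
     (if t = 0 then
        (p m * measure \<mu> \<Gamma> * ln (\<rho> m) +
          (\<Sum>m'\<in>{1..M} - {m}. barycentre_rule M s \<Gamma> \<mu> [m'] h (\<lambda>x. Phi t x \<eta>)))
        / (1 - p m)
      else
        (\<Sum>m'\<in>{1..M} - {m}. barycentre_rule M s \<Gamma> \<mu> [m'] h (\<lambda>x. Phi t x \<eta>))
        / (1 - p m * \<rho> m powr (- t)))"

definition hull_distance ::
  "nat \<Rightarrow> (nat \<Rightarrow> real^'n \<Rightarrow> real^'n) \<Rightarrow> (real^'n) set \<Rightarrow> real \<Rightarrow> nat \<Rightarrow> real^'n \<Rightarrow> real" where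
  "hull_distance M s \<Gamma> h m \<eta> =
     Min ((\<lambda>ks. infdist \<eta> (convex hull component s \<Gamma> ks)) `
            {ks \<in> L_index M s \<Gamma> [] h. hd ks \<noteq> m})"

definition a_const :: "real \<Rightarrow> real" where
  "a_const t = (if t = 0 then 2 else t * (t + 2))"

end

theory Submission
  imports Defs "HOL-Library.Sublist"
begin

text \<open>
  Scaling towards \<open>\<eta>\<close> by \<open>s m\<close> multiplies \<open>|x - \<eta>|\<close> by \<open>\<rho> m\<close>, so \<open>Phi t (s m x) \<eta>\<close> is
  \<open>\<rho> m powr (-t) * Phi t x \<eta>\<close>, or \<open>Phi 0 x \<eta> + ln (\<rho> m)\<close> in the logarithmic case. Splitting
  \<open>\<Gamma>\<close> into the piece of letter \<open>m\<close>, where \<open>\<mu>\<close> is \<open>p m\<close> times the image of \<open>\<mu>\<close> under \<open>s m\<close>, and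
  the remaining pieces therefore turns the singular integral into a linear equation for itself,
  \<open>I = p m * \<rho> m powr (-t) * I + F\<close>. Up to the explicit term
  \<open>p m * \<mu>(\<Gamma>) * ln (\<rho> m)\<close> for \<open>t = 0\<close>, \<open>F\<close> is an integral over finitely many cells of diameter
  at most \<open>h\<close> away from \<open>\<eta>\<close>, and the rule is the solution of this equation with that integral
  replaced by its barycentre approximation. The barycentre annihilates the linear Taylor
  term on each cell, so only the second derivative, of size at most
  \<open>a_const t * R powr -(t + 2)\<close> at distance \<open>R\<close>, contributes (\<open>barycentre_rule_cell_error\<close>,
  \<open>integral_Phi_eq\<close>, \<open>singular_rule_error\<close>).

  Two points need more than this computation.

  The splitting requires that distinct pieces of \<open>\<Gamma>\<close> meet in a \<open>\<mu>\<close>-null set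
  (\<open>measure_letter_overlap\<close>). This is where the open set condition enters, through an argument of
  Schief: the number of cells of size comparable to a given cell and touching it is bounded, and
  a word \<open>k\<close> for which this number is maximal is isolating: for nonempty \<open>v\<close> the cell
  \<open>v @ k\<close> touches no first-level piece other than its own (\<open>ex_isolating_word\<close>). Since the word \<open>k\<close>
  has positive weight, almost every address contains it after the first letter, and a point with such an
  address lies in only one first-level piece.

  The linear equation determines \<open>I\<close> only when \<open>I\<close> is finite. Truncating \<open>Phi t\<close> at height \<open>N\<close>
  gives the inequality \<open>I_N \<le> p m * \<rho> m powr (-t) * I_N + C\<close> with \<open>C\<close> independent of \<open>N\<close>; for
  \<open>t\<close> below the critical value the factor is less than 1, which bounds all \<open>I_N\<close>
  (\<open>integrable_Phi_pos\<close>).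
\<close>

section \<open>Words, cells and stopping sets\<close>

lemma word_map_append: "word_map s (u @ v) = word_map s u \<circ> word_map s v"
  by (induction u) (auto simp: fun_eq_iff)

lemma component_Nil [simp]: "component s \<Gamma> [] = \<Gamma>"
  by (simp add: component_def)

lemma component_append: "component s \<Gamma> (u @ v) = word_map s u ` component s \<Gamma> v"
  by (simp add: component_def word_map_append image_comp)

lemma component_Cons: "component s \<Gamma> (l # v) = s l ` component s \<Gamma> v"
  by (simp add: component_def image_comp)

text \<open>A packing bound without volumes: each ball of radius \<open>1/2\<close> of a finite cover contains at
  most one point of a 1-separated set.\<close>
lemma finite_card_of_separated:
  fixes C :: "'a::euclidean_space set"
  assumes "bounded C"
  obtains N :: nat where
    "\<And>S. S \<subseteq> C \<Longrightarrow> (\<And>x y. x \<in> S \<Longrightarrow> y \<in> S \<Longrightarrow> x \<noteq> y \<Longrightarrow> 1 \<le> dist x y) \<Longrightarrow> finite S \<and> card S \<le> N"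
proof -
  have "compact (closure C)"
    using assms by simp
  then obtain K where K: "finite K" "closure C \<subseteq> (\<Union>x\<in>K. ball x (1/2))"
    by (rule compactE_image[of _ "closure C" "\<lambda>x. ball x (1/2)"]) auto
  show thesis
  proof (rule that[of "card K"])
    fix S assume S: "S \<subseteq> C" and sep: "\<And>x y. x \<in> S \<Longrightarrow> y \<in> S \<Longrightarrow> x \<noteq> y \<Longrightarrow> 1 \<le> dist x y"
    have "\<forall>x\<in>S. \<exists>k\<in>K. dist k x < 1/2"
      using S K(2) closure_subset[of C] by fastforce
    then obtain g where g: "\<And>x. x \<in> S \<Longrightarrow> g x \<in> K" "\<And>x. x \<in> S \<Longrightarrow> dist (g x) x < 1/2"
      by metis
    have "inj_on g S"
    proof (rule inj_onI)
      fix x y assume "x \<in> S" "y \<in> S" "g x = g y"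
      then have "dist x y < 1"
        using g(2)[of x] g(2)[of y] dist_triangle3[of x y "g x"] by simp
      then show "x = y"
        using sep \<open>x \<in> S\<close> \<open>y \<in> S\<close> by force
    qed
    moreover have "g ` S \<subseteq> K"
      using g(1) by blast
    ultimately show "finite S \<and> card S \<le> card K"
      using K(1) by (meson card_inj_on_le inj_on_finite)
  qed
qed

locale self_similar_set =
  fixes M :: nat and \<rho> :: "nat \<Rightarrow> real" and s :: "nat \<Rightarrow> real^'n \<Rightarrow> real^'n" and \<Gamma> :: "(real^'n) set"
  assumes ratio_pos: "l \<in> {1..M} \<Longrightarrow> 0 < \<rho> l"
    and ratio_less_1: "l \<in> {1..M} \<Longrightarrow> \<rho> l < 1"
    and dist_s: "l \<in> {1..M} \<Longrightarrow> dist (s l x) (s l y) = \<rho> l * dist x y"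
    and attractor: "is_attractor M s \<Gamma>"
begin

abbreviation r :: "nat list \<Rightarrow> real" where "r w \<equiv> prod_list (map \<rho> w)"
abbreviation W :: "nat list \<Rightarrow> real^'n \<Rightarrow> real^'n" where "W \<equiv> word_map s"
abbreviation G :: "nat list \<Rightarrow> (real^'n) set" where "G \<equiv> component s \<Gamma>"

text \<open>The words at which the contraction ratio first drops to \<open>c\<close>. With \<open>c = h / diameter \<Gamma>\<close> this
  is the index set \<open>L_h\<close> of \<open>\<Gamma>\<close>; with \<open>c = r k\<close> it collects the cells comparable in size to
  the cell of \<open>k\<close>. Both uses rely on the same facts: such words are finite in number, their cells
  cover \<open>\<Gamma>\<close>, and none is a prefix of another.\<close>
definition cut :: "real \<Rightarrow> nat list set" where
  "cut c = {w. w \<noteq> [] \<and> set w \<subseteq> {1..M} \<and> r w \<le> c \<and> c < r (butlast w)}"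

lemma \<Gamma>_nonempty: "\<Gamma> \<noteq> {}" and \<Gamma>_compact: "compact \<Gamma>"
  and \<Gamma>_eq: "\<Gamma> = (\<Union>l\<in>{1..M}. s l ` \<Gamma>)"
  using attractor by (auto simp: is_attractor_def)

lemma image_s_subset: "l \<in> {1..M} \<Longrightarrow> s l ` \<Gamma> \<subseteq> \<Gamma>"
  by (subst (2) \<Gamma>_eq) blast

lemma ex_image_s: "x \<in> \<Gamma> \<Longrightarrow> \<exists>l\<in>{1..M}. x \<in> s l ` \<Gamma>"
  by (subst (asm) \<Gamma>_eq) blast

lemma word_ratio_pos: "set w \<subseteq> {1..M} \<Longrightarrow> 0 < r w"
  by (induction w) (auto simp: ratio_pos)

lemma dist_word_map: "set w \<subseteq> {1..M} \<Longrightarrow> dist (W w x) (W w y) = r w * dist x y"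
  by (induction w) (auto simp: dist_s)

lemma continuous_on_s: "l \<in> {1..M} \<Longrightarrow> continuous_on A (s l)"
  by (intro lipschitz_on_continuous_on[of "\<rho> l"] lipschitz_onI)
    (auto simp: dist_s ratio_pos less_imp_le)

lemma inj_s: "l \<in> {1..M} \<Longrightarrow> inj (s l)"
  by (metis dist_eq_0_iff dist_s injI mult_eq_0_iff order_less_irrefl ratio_pos)

lemma component_subset: "set w \<subseteq> {1..M} \<Longrightarrow> G w \<subseteq> \<Gamma>"
proof (induction w)
  case (Cons l w)
  then have "s l ` G w \<subseteq> s l ` \<Gamma>" by auto
  also have "\<dots> \<subseteq> \<Gamma>" using Cons.prems by (intro image_s_subset) auto
  finally show ?case by (simp add: component_Cons)
qed simp

lemma component_append_subset: "set v \<subseteq> {1..M} \<Longrightarrow> G (u @ v) \<subseteq> G u"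
  by (simp add: component_append component_def[of _ _ u] image_mono component_subset)

lemma component_nonempty: "G w \<noteq> {}"
  by (simp add: component_def \<Gamma>_nonempty)

lemma component_compact: "set w \<subseteq> {1..M} \<Longrightarrow> compact (G w)"
  by (induction w) (auto simp: component_Cons \<Gamma>_compact intro!: compact_continuous_image continuous_on_s)

lemma diameter_component:
  assumes "set w \<subseteq> {1..M}"
  shows "diameter (G w) = r w * diameter \<Gamma>"
proof (rule antisym)
  have "0 < r w" using assms by (rule word_ratio_pos)
  show "diameter (G w) \<le> r w * diameter \<Gamma>"
  proof (rule diameter_le)
    show "G w \<noteq> {} \<or> 0 \<le> r w * diameter \<Gamma>" by (simp add: component_nonempty)
    fix x y assume "x \<in> G w" "y \<in> G w"
    then obtain x' y' where "x = W w x'" "y = W w y'" "x' \<in> \<Gamma>" "y' \<in> \<Gamma>"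
      by (auto simp: component_def)
    then show "norm (x - y) \<le> r w * diameter \<Gamma>"
      using \<open>0 < r w\<close> diameter_bounded_bound[OF compact_imp_bounded[OF \<Gamma>_compact]]
      by (simp add: dist_norm[symmetric] dist_word_map[OF assms] mult_left_mono)
  qed
  obtain x y where xy: "x \<in> \<Gamma>" "y \<in> \<Gamma>" "dist x y = diameter \<Gamma>"
    using diameter_compact_attained[OF \<Gamma>_compact \<Gamma>_nonempty] by auto
  have "dist (W w x) (W w y) \<le> diameter (G w)"
    using xy by (intro diameter_bounded_bound compact_imp_bounded component_compact assms)
      (auto simp: component_def)
  then show "r w * diameter \<Gamma> \<le> diameter (G w)"
    using xy dist_word_map[OF assms] by simp
qed

lemma ratio_bounds:
  obtains q where "0 < q" "q < 1" "\<And>l. l \<in> {1..M} \<Longrightarrow> q \<le> \<rho> l \<and> \<rho> l \<le> 1 - q"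
proof
  let ?q = "Min (insert (1/2) (\<rho> ` {1..M} \<union> (\<lambda>l. 1 - \<rho> l) ` {1..M}))"
  show "0 < ?q"
    by (subst Min_gr_iff) (auto simp: ratio_pos ratio_less_1)
  show "?q < 1"
    by (subst Min_less_iff) auto
  fix l assume "l \<in> {1..M}"
  then have "?q \<le> \<rho> l" "?q \<le> 1 - \<rho> l"
    by (intro Min_le; simp)+
  then show "?q \<le> \<rho> l \<and> \<rho> l \<le> 1 - ?q" by simp
qed

lemma word_ratio_le_power:
  assumes "\<And>l. l \<in> {1..M} \<Longrightarrow> \<rho> l \<le> b" "0 \<le> b" "set w \<subseteq> {1..M}"
  shows "r w \<le> b ^ length w"
  using assms(3)
proof (induction w)
  case (Cons l w)
  then show ?case
    using assms(1,2) ratio_pos[of l] word_ratio_pos[of w] by (auto intro!: mult_mono intro: less_imp_le)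
qed simp

lemma ex_component_letter:
  assumes "x \<in> G u"
  obtains l where "l \<in> {1..M}" "x \<in> G (u @ [l])"
proof -
  obtain y where y: "y \<in> \<Gamma>" "x = W u y"
    using assms by (auto simp: component_def)
  obtain l where "l \<in> {1..M}" "y \<in> s l ` \<Gamma>"
    using ex_image_s[OF y(1)] by blast
  then show thesis
    using y(2) by (intro that[of l]) (auto simp: component_append component_Cons)
qed

text \<open>Following an address of \<open>x\<close> letter by letter, the ratio decreases at least geometrically,
  hence eventually falls below \<open>c\<close>.\<close>
lemma ex_cut_extension:
  assumes "x \<in> G u" "set u \<subseteq> {1..M}" "0 < c" "c < r u"
  obtains v where "u @ v \<in> cut c" "v \<noteq> []" "x \<in> G (u @ v)"
proof -
  obtain q where q: "0 < q" "q < 1" "\<And>l. l \<in> {1..M} \<Longrightarrow> q \<le> \<rho> l \<and> \<rho> l \<le> 1 - q"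
    by (rule ratio_bounds) blast
  have *: "r u * (1 - q) ^ N \<le> c \<Longrightarrow> x \<in> G u \<Longrightarrow> set u \<subseteq> {1..M} \<Longrightarrow> c < r u \<Longrightarrow>
      \<exists>v. u @ v \<in> cut c \<and> v \<noteq> [] \<and> x \<in> G (u @ v)" for N u
  proof (induction N arbitrary: u)
    case (Suc N)
    obtain l where l: "l \<in> {1..M}" "x \<in> G (u @ [l])"
      using ex_component_letter[OF Suc.prems(2)] .
    show ?case
    proof (cases "r (u @ [l]) \<le> c")
      case True
      then show ?thesis
        using l Suc.prems by (intro exI[of _ "[l]"]) (auto simp: cut_def butlast_append)
    next
      case False
      have "\<rho> l * (r u * (1 - q) ^ N) \<le> (1 - q) * (r u * (1 - q) ^ N)"
        using q l(1) word_ratio_pos[of u] Suc.prems(3) by (intro mult_right_mono) auto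
      then have "r (u @ [l]) * (1 - q) ^ N \<le> c"
        using Suc.prems(1) by (simp add: mult_ac)
      then obtain v where "(u @ [l]) @ v \<in> cut c" "x \<in> G ((u @ [l]) @ v)"
        using Suc.IH[of "u @ [l]"] l Suc.prems False by fastforce
      then show ?thesis
        by (intro exI[of _ "l # v"]) auto
    qed
  qed auto
  have "(\<lambda>N. r u * (1 - q) ^ N) \<longlonglongrightarrow> r u * 0"
    using q by (intro tendsto_intros LIMSEQ_power_zero) auto
  then have "eventually (\<lambda>N. r u * (1 - q) ^ N < c) sequentially"
    using assms(3) by (simp add: order_tendsto_iff)
  then obtain N where "r u * (1 - q) ^ N < c"
    by (auto simp: eventually_sequentially)
  then show thesis
    using *[of u N] assms that by auto
qed

lemma finite_cut:
  assumes "0 < c"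
  shows "finite (cut c)"
proof -
  obtain q where q: "0 < q" "q < 1" "\<And>l. l \<in> {1..M} \<Longrightarrow> q \<le> \<rho> l \<and> \<rho> l \<le> 1 - q"
    by (rule ratio_bounds) blast
  obtain N where N: "(1 - q) ^ N < c"
    using real_arch_pow_inv[of c "1 - q"] assms q by auto
  have "length w \<le> N" if "w \<in> cut c" for w
  proof (rule ccontr)
    assume "\<not> length w \<le> N"
    then have "(1 - q) ^ length (butlast w) \<le> (1 - q) ^ N"
      using q by (intro power_decreasing) auto
    moreover have "r (butlast w) \<le> (1 - q) ^ length (butlast w)"
      using that q by (intro word_ratio_le_power) (auto simp: cut_def dest: in_set_butlastD)
    ultimately show False
      using N that by (auto simp: cut_def)
  qed
  then have "cut c \<subseteq> {w. set w \<subseteq> {1..M} \<and> length w \<le> N}"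
    by (auto simp: cut_def)
  then show ?thesis
    by (rule finite_subset) (simp add: finite_lists_length_le)
qed

text \<open>Extending a word only decreases its ratio, so a word of the stopping set cannot be a proper
  prefix of another one; two of them must separate at some letter.\<close>
lemma cut_branching:
  assumes "u \<in> cut c" "v \<in> cut c" "u \<noteq> v"
  obtains w a b u' v' where "a \<noteq> b" "u = w @ a # u'" "v = w @ b # v'"
proof -
  have no_prefix: "\<not> prefix u v" if "u \<in> cut c" "v \<in> cut c" "u \<noteq> v" for u v
  proof
    assume "prefix u v"
    then obtain z where z: "v = u @ z" "z \<noteq> []"
      using \<open>u \<noteq> v\<close> by (auto simp: prefix_def)
    have "set (butlast z) \<subseteq> {1..M}"
      using that(2) z by (auto simp: cut_def dest: in_set_butlastD)
    then have "r (butlast z) \<le> 1"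
      using word_ratio_le_power[of 1 "butlast z"] by (simp add: less_imp_le ratio_less_1)
    then have "r (butlast v) \<le> r u"
      using z that(1) word_ratio_pos[of u] by (simp add: butlast_append cut_def mult_left_le)
    then show False
      using that by (simp add: cut_def)
  qed
  have "parallel u v"
    using assms no_prefix by blast
  then show thesis
    using parallel_decomp that by blast
qed

lemma word_ratio_less_1:
  assumes "w \<noteq> []" "set w \<subseteq> {1..M}"
  shows "r w < 1"
proof -
  obtain l v where w: "w = l # v"
    using assms(1) by (cases w) auto
  have "r v \<le> 1"
    using word_ratio_le_power[of 1 v] assms w by (simp add: less_imp_le ratio_less_1)
  then have "\<rho> l * r v \<le> \<rho> l"
    using assms w ratio_pos[of l] by (intro mult_left_le) auto
  then show ?thesis
    using assms w ratio_less_1[of l] by simp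
qed

text \<open>The bound \<open>c < 1\<close> makes \<open>[l]\<close> itself a stopping word when \<open>\<rho> l \<le> c\<close>; otherwise
  \<open>[l]\<close> is extended.\<close>
lemma ex_cut_component:
  assumes "x \<in> G [l]" "l \<in> {1..M}" "0 < c" "c < 1"
  obtains w where "w \<in> cut c" "hd w = l" "x \<in> G w"
proof (cases "r [l] \<le> c")
  case True
  then show thesis
    using assms by (intro that[of "[l]"]) (auto simp: cut_def)
next
  case False
  then obtain v where "[l] @ v \<in> cut c" "x \<in> G ([l] @ v)"
    using ex_cut_extension[OF assms(1) _ assms(3)] assms(2) by auto
  then show thesis
    by (intro that[of "[l] @ v"]) auto
qed

section \<open>The open set condition and isolating words\<close>

text \<open>Rescaled to ratio 1 and moved to fix the origin, \<open>s l\<close> is an isometry, hence orthogonal.\<close>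
lemma surj_s:
  assumes "l \<in> {1..M}"
  shows "surj (s l)"
proof -
  define g where "g x = (s l x - s l 0) /\<^sub>R \<rho> l" for x
  have pos: "0 < \<rho> l" using assms by (rule ratio_pos)
  have "dist (g x) (g y) = dist x y" for x y
  proof -
    have "g x - g y = (s l x - s l y) /\<^sub>R \<rho> l"
      by (simp add: g_def scaleR_diff_right)
    then have "dist (g x) (g y) = dist (s l x) (s l y) / \<rho> l"
      using pos by (simp add: dist_norm divide_inverse_commute)
    then show ?thesis
      using pos by (simp add: dist_s[OF assms])
  qed
  then have "orthogonal_transformation g"
    by (simp add: orthogonal_transformation_isometry g_def)
  then have "surj g"
    by (rule orthogonal_transformation_surj)
  have "\<exists>x. s l x = y" for y
  proof -
    obtain x where "g x = (y - s l 0) /\<^sub>R \<rho> l"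
      using \<open>surj g\<close> by (metis surjD)
    then have "s l x = y"
      using pos by (simp add: g_def)
    then show ?thesis ..
  qed
  then show ?thesis
    by (metis surjI someI_ex)
qed

lemma bij_word_map: "set w \<subseteq> {1..M} \<Longrightarrow> bij (W w)"
proof (induction w)
  case (Cons l w)
  then show ?case
    using inj_s[of l] surj_s[of l] bij_comp[of "W w" "s l"] by (simp add: bij_def[of "s l"] comp_def)
qed simp

lemma ball_subset_image_word_map:
  assumes "set w \<subseteq> {1..M}"
  shows "ball (W w a) (r w * e) \<subseteq> W w ` ball a e"
proof
  fix y assume y: "y \<in> ball (W w a) (r w * e)"
  obtain x where x: "y = W w x"
    using bij_word_map[OF assms] by (metis bij_pointE)
  then have "x \<in> ball a e"
    using y word_ratio_pos[OF assms] by (simp add: dist_word_map[OF assms])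
  then show "y \<in> W w ` ball a e"
    using x by blast
qed

definition neighbours :: "nat list \<Rightarrow> nat list set" where
  "neighbours k = {i \<in> cut (r k). G i \<inter> G k \<noteq> {}}"

lemma finite_neighbours: "set k \<subseteq> {1..M} \<Longrightarrow> finite (neighbours k)"
  by (simp add: neighbours_def finite_cut word_ratio_pos)

text \<open>Applying \<open>W v\<close> carries a configuration of touching cells of comparable size to another such
  configuration. A prefix can thus only add neighbours.\<close>
lemma append_neighbours:
  assumes "set v \<subseteq> {1..M}"
  shows "(@) v ` neighbours k \<subseteq> neighbours (v @ k)"
proof
  fix j assume "j \<in> (@) v ` neighbours k"
  then obtain i where i: "i \<in> cut (r k)" "G i \<inter> G k \<noteq> {}" "j = v @ i"
    by (auto simp: neighbours_def)
  have "0 < r v" using assms by (rule word_ratio_pos)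
  then have "j \<in> cut (r (v @ k))"
    using i assms by (auto simp: cut_def butlast_append)
  moreover have "G j \<inter> G (v @ k) \<noteq> {}"
    using i(2,3) by (auto simp: component_append)
  ultimately show "j \<in> neighbours (v @ k)"
    by (simp add: neighbours_def)
qed

end

locale self_similar_set_osc = self_similar_set M \<rho> s \<Gamma>
  for M :: nat and \<rho> :: "nat \<Rightarrow> real" and s :: "nat \<Rightarrow> real^'n \<Rightarrow> real^'n" and \<Gamma> :: "(real^'n) set" +
  assumes osc: "open_set_condition M s"
begin

text \<open>Fix a ball \<open>ball a e\<close> inside the open set. The neighbours \<open>i\<close> of \<open>k\<close> branch pairwise, so their
  copies of the ball are disjoint, which separates the points \<open>W i a\<close> by \<open>e * r i\<close>, a quantity of
  order \<open>r k\<close>; on the other hand all these points lie within distance of order \<open>r k\<close> of the cell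
  \<open>k\<close>. Rescaling by \<open>r k\<close> gives a 1-separated set in a fixed ball.\<close>
lemma bounded_card_neighbours:
  obtains N where "\<And>k. set k \<subseteq> {1..M} \<Longrightarrow> card (neighbours k) \<le> N"
proof -
  obtain U where U: "U \<noteq> {}" "open U" "(\<Union>l\<in>{1..M}. s l ` U) \<subseteq> U"
    and *: "\<forall>l\<in>{1..M}. \<forall>l'\<in>{1..M}. l \<noteq> l' \<longrightarrow> s l ` U \<inter> s l' ` U = {}"
    using osc unfolding open_set_condition_def by (elim exE conjE) (rule that)
  have disj: "s l ` U \<inter> s l' ` U = {}" if "l \<in> {1..M}" "l' \<in> {1..M}" "l \<noteq> l'" for l l'
    using * that by blast
  obtain a e where e: "0 < e" "ball a e \<subseteq> U"
    using U(1,2) by (meson all_not_in_conv open_contains_ball)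
  obtain x0 where x0: "x0 \<in> \<Gamma>" using \<Gamma>_nonempty by blast
  obtain q where q: "0 < q" "q < 1" "\<And>l. l \<in> {1..M} \<Longrightarrow> q \<le> \<rho> l \<and> \<rho> l \<le> 1 - q"
    by (rule ratio_bounds) blast
  have bdd: "bounded \<Gamma>" using \<Gamma>_compact by (rule compact_imp_bounded)
  then obtain D where D: "\<And>x. x \<in> \<Gamma> \<Longrightarrow> dist a x \<le> D"
    by (meson bounded_any_center)
  have invU: "W w ` U \<subseteq> U" if "set w \<subseteq> {1..M}" for w
    using that
  proof (induction w)
    case (Cons l w)
    then have "s l ` W w ` U \<subseteq> s l ` U" "l \<in> {1..M}" by auto
    moreover from this(2) have "s l ` U \<subseteq> U" using U(3) by blast
    ultimately show ?case by (simp add: image_comp)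
  qed simp
  have sep: "e * r i \<le> dist (W i a) (W j a)" if ij: "i \<in> cut c" "j \<in> cut c" "i \<noteq> j" for i j c
  proof (rule ccontr)
    assume "\<not> e * r i \<le> dist (W i a) (W j a)"
    moreover have i: "set i \<subseteq> {1..M}" and j: "set j \<subseteq> {1..M}"
      using ij by (auto simp: cut_def)
    ultimately have "W j a \<in> W i ` ball a e"
      using ball_subset_image_word_map[of i a e] by (auto simp: mult.commute)
    then have ne: "W i ` U \<inter> W j ` U \<noteq> {}"
      using e centre_in_ball[of a e] by blast
    obtain w b c u v where w: "b \<noteq> c" "i = w @ b # u" "j = w @ c # v"
      using cut_branching[OF ij] by metis
    have "W i ` U \<subseteq> W w ` s b ` U" "W j ` U \<subseteq> W w ` s c ` U"
      using invU[of u] invU[of v] i j w by (auto simp: word_map_append)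
    moreover have "W w ` s b ` U \<inter> W w ` s c ` U = {}"
      using disj[of b c] i j w bij_is_inj[OF bij_word_map, of w] by (simp flip: image_Int)
    ultimately show False using ne by blast
  qed
  have "bounded (cball (0 :: real^'n) ((D + diameter \<Gamma>) / (e * q)))" by simp
  then obtain N :: nat where
    N: "\<And>S. S \<subseteq> cball (0 :: real^'n) ((D + diameter \<Gamma>) / (e * q)) \<Longrightarrow>
      (\<And>x y. x \<in> S \<Longrightarrow> y \<in> S \<Longrightarrow> x \<noteq> y \<Longrightarrow> 1 \<le> dist x y) \<Longrightarrow> finite S \<and> card S \<le> N"
    by (rule finite_card_of_separated) blast
  show thesis
  proof (rule that)
    fix k assume k: "set k \<subseteq> {1..M}"
    then have rk: "0 < r k" by (rule word_ratio_pos)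
    define f where "f i = (W i a - W k x0) /\<^sub>R (e * q * r k)" for i
    have dist_f: "dist (f i) (f j) = dist (W i a) (W j a) / (e * q * r k)" for i j
    proof -
      have "f i - f j = (W i a - W j a) /\<^sub>R (e * q * r k)"
        by (simp add: f_def scaleR_diff_right)
      then show ?thesis
        using rk e q by (simp add: dist_norm divide_inverse_commute)
    qed
    have f_sep: "1 \<le> dist (f i) (f j)" if "i \<in> neighbours k" "j \<in> neighbours k" "i \<noteq> j" for i j
    proof -
      have i: "i \<in> cut (r k)" using that by (simp add: neighbours_def)
      then obtain w l where w: "i = w @ [l]" by (cases i rule: rev_cases) (auto simp: cut_def)
      have "r k * q \<le> r w * \<rho> l"
        using i w q rk by (intro mult_mono) (auto simp: cut_def word_ratio_pos less_imp_le)
      then have "q * r k \<le> r i"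
        using w by (simp add: mult.commute)
      then have "e * (q * r k) \<le> e * r i"
        using e by simp
      also have "\<dots> \<le> dist (W i a) (W j a)"
        using that by (intro sep) (auto simp: neighbours_def)
      finally show ?thesis
        using e q rk by (simp add: dist_f field_simps)
    qed
    have f_ball: "f i \<in> cball 0 ((D + diameter \<Gamma>) / (e * q))" if "i \<in> neighbours k" for i
    proof -
      have i: "set i \<subseteq> {1..M}" "r i \<le> r k" and "W i ` \<Gamma> \<inter> W k ` \<Gamma> \<noteq> {}"
        using that by (auto simp: neighbours_def component_def cut_def)
      then obtain y z where yz: "y \<in> \<Gamma>" "z \<in> \<Gamma>" "W i y = W k z"
        by auto
      have "dist (W i a) (W k x0) \<le> dist (W i a) (W i y) + dist (W k z) (W k x0)"
        using yz(3) by (metis dist_triangle)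
      also have "\<dots> = r i * dist a y + r k * dist z x0"
        by (simp only: dist_word_map[OF i(1)] dist_word_map[OF k])
      also have "\<dots> \<le> r k * D + r k * diameter \<Gamma>"
        using D[OF yz(1)] diameter_bounded_bound[OF bdd yz(2) x0] rk i(2) word_ratio_pos[OF i(1)]
        by (intro add_mono mult_mono) auto
      finally have le: "dist (W i a) (W k x0) \<le> r k * (D + diameter \<Gamma>)"
        by (simp add: algebra_simps)
      have "norm (f i) = dist (W i a) (W k x0) / (e * q * r k)"
        using e q rk by (simp add: f_def dist_norm divide_inverse_commute)
      also have "\<dots> \<le> r k * (D + diameter \<Gamma>) / (e * q * r k)"
        using e q rk by (intro divide_right_mono le) simp
      also have "\<dots> = (D + diameter \<Gamma>) / (e * q)"
        using rk by simp
      finally show ?thesis by simp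
    qed
    have "inj_on f (neighbours k)"
      using f_sep by (fastforce intro!: inj_onI)
    then show "card (neighbours k) \<le> N"
      using N[of "f ` neighbours k"] f_sep f_ball by (force simp: card_image)
  qed
qed

text \<open>Choose \<open>k\<close> with the largest number of neighbours. Prefixing \<open>v\<close> cannot add any
  by maximality, so every neighbour of \<open>v @ k\<close> starts with \<open>v\<close>. If the
  cell \<open>v @ k\<close> met the piece \<open>l\<close>, then some cell of comparable size inside that piece would be a
  neighbour starting with \<open>l\<close>, whence \<open>l = hd v\<close>.\<close>
lemma ex_isolating_word:
  obtains k where "set k \<subseteq> {1..M}"
    "\<And>v l. v \<noteq> [] \<Longrightarrow> set v \<subseteq> {1..M} \<Longrightarrow> l \<in> {1..M} \<Longrightarrow> l \<noteq> hd v \<Longrightarrow> G (v @ k) \<inter> G [l] = {}"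
proof -
  obtain N where N: "\<And>k. set k \<subseteq> {1..M} \<Longrightarrow> card (neighbours k) \<le> N"
    by (rule bounded_card_neighbours) blast
  obtain k where k: "set k \<subseteq> {1..M}"
    and max: "\<And>k'. set k' \<subseteq> {1..M} \<Longrightarrow> card (neighbours k') \<le> card (neighbours k)"
    using ex_has_greatest_nat[of "\<lambda>k. set k \<subseteq> {1..M}" "[]" "\<lambda>k. card (neighbours k)" "Suc N"] N
    by (auto simp: less_Suc_eq_le)
  show thesis
  proof (rule that[OF k])
    fix v l assume v: "v \<noteq> []" "set v \<subseteq> {1..M}" and l: "l \<in> {1..M}" "l \<noteq> hd v"
    have vk: "set (v @ k) \<subseteq> {1..M}" using v k by simp
    have "neighbours (v @ k) = (@) v ` neighbours k"
      using append_neighbours[OF v(2)] max[OF vk] finite_neighbours[OF vk]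
      by (intro card_seteq[symmetric]) (auto simp: card_image inj_on_def)
    then have hd_eq: "hd i = hd v" if "i \<in> neighbours (v @ k)" for i
      using that v(1) by auto
    show "G (v @ k) \<inter> G [l] = {}"
    proof (rule ccontr)
      assume "G (v @ k) \<inter> G [l] \<noteq> {}"
      then obtain x where x: "x \<in> G (v @ k)" "x \<in> G [l]" by blast
      obtain i where "i \<in> cut (r (v @ k))" "hd i = l" "x \<in> G i"
        using ex_cut_component[OF x(2) l(1) word_ratio_pos[OF vk]] word_ratio_less_1[OF _ vk] v by auto
      then show False
        using hd_eq x(1) l by (auto simp: neighbours_def)
    qed
  qed
qed

end

section \<open>Invariant measures do not charge overlaps\<close>
locale self_similar_measure = self_similar_set_osc M \<rho> s \<Gamma>
  for M :: nat and \<rho> :: "nat \<Rightarrow> real" and s :: "nat \<Rightarrow> real^'n \<Rightarrow> real^'n" and \<Gamma> :: "(real^'n) set" +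
  fixes p :: "nat \<Rightarrow> real" and \<mu> :: "(real^'n) measure"
  assumes invariant: "invariant_measure M s p \<Gamma> \<mu>"
begin

abbreviation P :: "nat list \<Rightarrow> real" where "P w \<equiv> prod_list (map p w)"

lemma weight_pos: "l \<in> {1..M} \<Longrightarrow> 0 < p l" and weight_less_1: "l \<in> {1..M} \<Longrightarrow> p l < 1"
  and sum_weights: "(\<Sum>l=1..M. p l) = 1" and sets_\<mu> [measurable_cong, simp]: "sets \<mu> = sets borel"
  and measure_compl_\<Gamma>: "measure \<mu> (- \<Gamma>) = 0" and measure_UNIV: "measure \<mu> UNIV \<noteq> 0"
  and measure_invariant:
    "A \<in> sets borel \<Longrightarrow> measure \<mu> A = (\<Sum>l=1..M. p l * measure \<mu> (s l -` A))"
  using invariant unfolding invariant_measure_def by blast+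

sublocale finite_measure \<mu>
  using invariant unfolding invariant_measure_def by blast

lemma space_\<mu> [simp]: "space \<mu> = UNIV"
  using sets_eq_imp_space_eq[OF sets_\<mu>] by simp

lemma word_weight_pos: "set w \<subseteq> {1..M} \<Longrightarrow> 0 < P w"
  by (induction w) (auto simp: weight_pos)

lemma borel_\<Gamma> [measurable]: "\<Gamma> \<in> sets borel"
  using \<Gamma>_compact by (rule borel_compact)

lemma borel_component: "set w \<subseteq> {1..M} \<Longrightarrow> G w \<in> sets borel"
  using component_compact by (rule borel_compact)

lemma AE_\<Gamma>: "AE x in \<mu>. x \<in> \<Gamma>"
proof -
  have "- \<Gamma> \<in> null_sets \<mu>"
    by (rule null_setsI) (auto simp: emeasure_eq_measure measure_compl_\<Gamma>)
  then show ?thesis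
    by (rule AE_I') auto
qed

lemma measure_cong_\<Gamma>:
  assumes "A \<in> sets borel" "B \<in> sets borel" "A \<inter> \<Gamma> = B \<inter> \<Gamma>"
  shows "measure \<mu> A = measure \<mu> B"
  using assms AE_\<Gamma> by (intro finite_measure_eq_AE) (auto elim!: eventually_mono)

lemma borel_vimage_word_map:
  assumes "set w \<subseteq> {1..M}" "A \<in> sets borel"
  shows "W w -` A \<in> sets borel"
proof -
  have "continuous_on UNIV (W w)"
    by (rule lipschitz_on_continuous_on[of "r w"])
      (auto intro!: lipschitz_onI simp: dist_word_map[OF assms(1)] word_ratio_pos[OF assms(1)] less_imp_le)
  then have "W w \<in> borel_measurable borel"
    by (rule borel_measurable_continuous_onI)
  from measurable_sets_borel[OF this assms(2)] show ?thesis .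
qed

lemma measurable_s: "l \<in> {1..M} \<Longrightarrow> s l \<in> borel_measurable borel"
  by (intro borel_measurable_continuous_onI continuous_on_s)

lemma borel_vimage_s: "l \<in> {1..M} \<Longrightarrow> A \<in> sets borel \<Longrightarrow> s l -` A \<in> sets borel"
  using borel_vimage_word_map[of "[l]" A] by simp

text \<open>By invariance \<open>\<mu> A\<close> is the average of the measures of \<open>W u -` A\<close> over the words \<open>u\<close> of the length
  of \<open>k\<close>; the word \<open>k\<close> itself, of weight \<open>P k\<close>, contributes nothing.\<close>
lemma measure_le_of_null_vimage:
  assumes "set k \<subseteq> {1..M}" "A \<in> sets borel" "measure \<mu> (W k -` A) = 0"
    and "\<And>u. set u \<subseteq> {1..M} \<Longrightarrow> measure \<mu> (W u -` A) \<le> S"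
  shows "measure \<mu> A \<le> (1 - P k) * S"
  using assms
proof (induction k arbitrary: A)
  case (Cons l k)
  have l: "l \<in> {1..M}" using Cons.prems(1) by simp
  have S: "measure \<mu> (s j -` A) \<le> S" if "j \<in> {1..M}" for j
    using Cons.prems(4)[of "[j]"] that by simp
  have "measure \<mu> (s l -` A) \<le> (1 - P k) * S"
  proof (rule Cons.IH)
    show "set k \<subseteq> {1..M}" using Cons.prems(1) by simp
    show "s l -` A \<in> sets borel" using l Cons.prems(2) by (rule borel_vimage_s)
    show "measure \<mu> (W k -` s l -` A) = 0"
      using Cons.prems(3) by (simp add: vimage_comp comp_def)
    fix u :: "nat list" assume "set u \<subseteq> {1..M}"
    then show "measure \<mu> (W u -` s l -` A) \<le> S"
      using Cons.prems(4)[of "l # u"] l by (simp add: vimage_comp comp_def)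
  qed
  then have *: "p l * measure \<mu> (s l -` A) \<le> p l * ((1 - P k) * S)"
    using weight_pos[OF l] by simp
  have "measure \<mu> A = p l * measure \<mu> (s l -` A) + (\<Sum>j\<in>{1..M} - {l}. p j * measure \<mu> (s j -` A))"
    using measure_invariant[OF Cons.prems(2)] l by (simp add: sum.remove)
  also have "\<dots> \<le> p l * ((1 - P k) * S) + (\<Sum>j\<in>{1..M} - {l}. p j * S)"
    using S weight_pos by (intro add_mono * sum_mono mult_left_mono) (auto intro: less_imp_le)
  also have "(\<Sum>j\<in>{1..M} - {l}. p j * S) = (1 - p l) * S"
    using sum_weights l by (simp add: sum_distrib_right[symmetric] sum_diff1)
  finally show ?case
    by (simp add: algebra_simps)
qed simp

text \<open>Let \<open>E\<close> be the overlap and \<open>S\<close> the supremum of the measures of \<open>W v -` E\<close> over nonempty \<open>v\<close>. A cell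
  \<open>v @ k\<close> ending in an isolating word \<open>k\<close> misses \<open>G [i]\<close> or \<open>G [j]\<close>, as \<open>hd v\<close> differs from at least
  one of \<open>i\<close>, \<open>j\<close>; so \<open>W (v @ k) -` E\<close> is null, and \<open>S \<le> (1 - P k) * S\<close> forces \<open>S = 0\<close>.\<close>
lemma measure_letter_overlap:
  assumes ij: "i \<in> {1..M}" "j \<in> {1..M}" "i \<noteq> j"
  shows "measure \<mu> (G [i] \<inter> G [j]) = 0"
proof -
  define E where "E = G [i] \<inter> G [j]"
  have E: "E \<in> sets borel"
    unfolding E_def using ij by (intro sets.Int borel_component) auto
  obtain k where k: "set k \<subseteq> {1..M}"
    and iso: "\<And>v l. v \<noteq> [] \<Longrightarrow> set v \<subseteq> {1..M} \<Longrightarrow> l \<in> {1..M} \<Longrightarrow> l \<noteq> hd v \<Longrightarrow> G (v @ k) \<inter> G [l] = {}"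
    by (rule ex_isolating_word) blast
  let ?V = "{v. v \<noteq> [] \<and> set v \<subseteq> {1..M}}"
  define S where "S = (SUP v\<in>?V. measure \<mu> (W v -` E))"
  have "bdd_above ((\<lambda>v. measure \<mu> (W v -` E)) ` ?V)"
    using bounded_measure by (intro bdd_aboveI[of _ "measure \<mu> (space \<mu>)"]) auto
  then have le_S: "measure \<mu> (W v -` E) \<le> S" if "v \<in> ?V" for v
    unfolding S_def using that by (intro cSUP_upper)
  have "measure \<mu> (W v -` E) \<le> (1 - P k) * S" if v: "v \<in> ?V" for v
  proof (rule measure_le_of_null_vimage[OF k])
    show "W v -` E \<in> sets borel"
      using v E by (intro borel_vimage_word_map) auto
    show "measure \<mu> (W u -` W v -` E) \<le> S" if "set u \<subseteq> {1..M}" for u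
      using le_S[of "v @ u"] that v by (simp add: word_map_append vimage_comp)
    have "y \<notin> W k -` W v -` E" if "y \<in> \<Gamma>" for y
    proof
      assume "y \<in> W k -` W v -` E"
      then have "W (v @ k) y \<in> G (v @ k) \<inter> G [i] \<inter> G [j]"
        using that by (auto simp: E_def word_map_append component_def)
      then show False
        using iso[of v i] iso[of v j] ij v by auto
    qed
    then have "measure \<mu> (W k -` W v -` E) = measure \<mu> {}"
      using v k E by (intro measure_cong_\<Gamma> borel_vimage_word_map) auto
    then show "measure \<mu> (W k -` W v -` E) = 0" by simp
  qed
  then have "S \<le> (1 - P k) * S"
    unfolding S_def[of] using ij by (intro cSUP_least) (auto intro: exI[of _ "[i]"])
  then have "P k * S \<le> 0" by (simp add: algebra_simps)
  then have "S \<le> 0"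
    using word_weight_pos[OF k] by (simp add: mult_le_0_iff)
  then have "measure \<mu> (s l -` E) = 0" if "l \<in> {1..M}" for l
    using le_S[of "[l]"] that measure_nonneg[of \<mu> "s l -` E"] by (simp add: order_antisym)
  then show ?thesis
    using measure_invariant[OF E] by (simp add: E_def)
qed

text \<open>In the invariance identity for \<open>A \<inter> G [m]\<close>, a letter \<open>l\<close> other than \<open>m\<close> only sees the part of
  \<open>A\<close> inside the overlap of \<open>G [l]\<close> and \<open>G [m]\<close>, which is null.\<close>
lemma measure_Int_letter:
  assumes m: "m \<in> {1..M}" and A: "A \<in> sets borel"
  shows "measure \<mu> (A \<inter> G [m]) = p m * measure \<mu> (s m -` A)"
proof -
  have Gm: "G [l] \<in> sets borel" if "l \<in> {1..M}" for l
    using that by (intro borel_component) auto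
  have 0: "measure \<mu> (s l -` (A \<inter> G [m])) = 0" if l: "l \<in> {1..M} - {m}" for l
  proof -
    let ?E = "G [l] \<inter> G [m]"
    have E: "?E \<in> sets borel" using l m by (intro sets.Int Gm) auto
    have "(\<Sum>j=1..M. p j * measure \<mu> (s j -` ?E)) = 0"
      using measure_invariant[OF E] measure_letter_overlap[of l m] l m by simp
    then have "\<forall>j\<in>{1..M}. p j * measure \<mu> (s j -` ?E) = 0"
      using weight_pos by (subst (asm) sum_nonneg_eq_0_iff) (auto intro!: mult_nonneg_nonneg intro: less_imp_le)
    then have "measure \<mu> (s l -` ?E) = 0"
      using l weight_pos[of l] by fastforce
    moreover have "measure \<mu> (s l -` (A \<inter> G [m])) = measure \<mu> (s l -` (A \<inter> ?E))"
      using A E l m Gm[OF m] Gm[of l] by (intro measure_cong_\<Gamma> borel_vimage_s sets.Int) (auto simp: component_Cons)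
    moreover have "measure \<mu> (s l -` (A \<inter> ?E)) \<le> measure \<mu> (s l -` ?E)"
      using borel_vimage_s[OF _ E, of l] l by (intro finite_measure_mono) auto
    ultimately show ?thesis
      using measure_nonneg[of \<mu> "s l -` (A \<inter> ?E)"] by linarith
  qed
  have "measure \<mu> (A \<inter> G [m]) = (\<Sum>l=1..M. p l * measure \<mu> (s l -` (A \<inter> G [m])))"
    using A Gm[OF m] by (intro measure_invariant sets.Int)
  also have "\<dots> = p m * measure \<mu> (s m -` (A \<inter> G [m]))"
    using m 0 by (simp add: sum.remove)
  also have "measure \<mu> (s m -` (A \<inter> G [m])) = measure \<mu> (s m -` A)"
    using A m Gm[OF m] inj_s[OF m]
    by (intro measure_cong_\<Gamma> borel_vimage_s sets.Int) (auto simp: component_Cons)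
  finally show ?thesis .
qed

lemma measure_Int_component:
  assumes "set w \<subseteq> {1..M}" "A \<in> sets borel"
  shows "measure \<mu> (A \<inter> G w) = P w * measure \<mu> (W w -` A)"
  using assms
proof (induction w arbitrary: A)
  case Nil
  then show ?case by (auto intro: measure_cong_\<Gamma>)
next
  case (Cons l w)
  have l: "l \<in> {1..M}" and w: "set w \<subseteq> {1..M}" using Cons.prems(1) by auto
  have sub: "G (l # w) \<subseteq> G [l]"
    using component_append_subset[OF w, of "[l]"] by simp
  then have "measure \<mu> (A \<inter> G (l # w)) = measure \<mu> ((A \<inter> G (l # w)) \<inter> G [l])"
    by (intro arg_cong[of _ _ "measure \<mu>"]) auto
  also have "\<dots> = p l * measure \<mu> (s l -` (A \<inter> G (l # w)))"
    using Cons.prems by (intro measure_Int_letter l sets.Int borel_component)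
  also have "s l -` (A \<inter> G (l # w)) = s l -` A \<inter> G w"
    using inj_s[OF l] by (auto simp: component_Cons inj_def)
  also have "measure \<mu> \<dots> = P w * measure \<mu> (W w -` s l -` A)"
    using w l Cons.prems(2) by (intro Cons.IH borel_vimage_s)
  finally show ?case
    by (simp add: vimage_comp comp_def)
qed

lemma measure_component_pos: "set w \<subseteq> {1..M} \<Longrightarrow> 0 < measure \<mu> (G w)"
  using measure_Int_component[of w UNIV] word_weight_pos[of w] measure_UNIV
  by (simp add: zero_less_measure_iff)

lemma measure_cut_overlap:
  assumes uv: "u \<in> cut c" "v \<in> cut c" "u \<noteq> v"
  shows "measure \<mu> (G u \<inter> G v) = 0"
proof -
  obtain w a b u' v' where w: "a \<noteq> b" "u = w @ a # u'" "v = w @ b # v'"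
    by (rule cut_branching[OF uv])
  have sets: "set w \<subseteq> {1..M}" "a \<in> {1..M}" "b \<in> {1..M}" "set u' \<subseteq> {1..M}" "set v' \<subseteq> {1..M}"
    using uv w by (auto simp: cut_def)
  let ?E = "G (w @ [a]) \<inter> G (w @ [b])"
  have inj: "inj (W w)" using bij_word_map[OF sets(1)] by (rule bij_is_inj)
  have E: "?E \<in> sets borel"
    using sets by (intro sets.Int borel_component) auto
  have "?E \<inter> G w = ?E"
    using component_append_subset[of "[a]" w] sets by auto
  moreover have "W w -` ?E = G [a] \<inter> G [b]"
    using inj by (simp add: component_append inj_vimage_image_eq flip: image_Int)
  ultimately have "measure \<mu> ?E = P w * measure \<mu> (G [a] \<inter> G [b])"
    using measure_Int_component[OF sets(1) E] by simp
  then have "measure \<mu> ?E = 0"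
    using measure_letter_overlap[OF sets(2,3) w(1)] by simp
  moreover have "G u \<inter> G v \<subseteq> ?E"
    using component_append_subset[OF sets(4), of "w @ [a]"]
      component_append_subset[OF sets(5), of "w @ [b]"] w by auto
  then have "measure \<mu> (G u \<inter> G v) \<le> measure \<mu> ?E"
    using E by (intro finite_measure_mono) auto
  ultimately show ?thesis
    by (simp add: measure_le_0_iff)
qed

text \<open>The integral form of \<open>measure_Int_letter\<close>, which states that \<open>\<mu>\<close> restricted to \<open>G [m]\<close> and
  \<open>p m\<close> times the image of \<open>\<mu>\<close> under \<open>s m\<close> are the same measure. It holds
  for non-integrable \<open>f\<close> as well, both sides being 0 then.\<close>
lemma set_integral_letter:
  fixes f :: "real^'n \<Rightarrow> real"
  assumes m: "m \<in> {1..M}" and f [measurable]: "f \<in> borel_measurable borel"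
  shows "(LINT x:G [m]|\<mu>. f x) = p m * (LINT x|\<mu>. f (s m x))"
proof -
  have [measurable]: "G [m] \<in> sets borel" using m by (intro borel_component) auto
  have [measurable]: "s m \<in> borel_measurable borel" using m by (rule measurable_s)
  have "density \<mu> (\<lambda>x. ennreal (indicator (G [m]) x)) = density (distr \<mu> borel (s m)) (\<lambda>_. ennreal (p m))"
  proof (rule measure_eqI)
    fix A assume "A \<in> sets (density \<mu> (\<lambda>x. ennreal (indicator (G [m]) x)))"
    then have A [measurable]: "A \<in> sets borel" by simp
    have "emeasure (density \<mu> (\<lambda>x. ennreal (indicator (G [m]) x))) A = emeasure \<mu> (A \<inter> G [m])"
      by (simp add: emeasure_density ennreal_indicator indicator_inter_arith[symmetric] Int_commute)
    also have "\<dots> = ennreal (p m) * emeasure \<mu> (s m -` A)"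
      using measure_Int_letter[OF m A] weight_pos[OF m] by (simp add: emeasure_eq_measure ennreal_mult)
    finally show "emeasure (density \<mu> (\<lambda>x. ennreal (indicator (G [m]) x))) A =
        emeasure (density (distr \<mu> borel (s m)) (\<lambda>_. ennreal (p m))) A"
      by (simp add: emeasure_density_const emeasure_distr)
  qed simp
  then have "integral\<^sup>L (density \<mu> (\<lambda>x. ennreal (indicator (G [m]) x))) f =
      integral\<^sup>L (density (distr \<mu> borel (s m)) (\<lambda>_. ennreal (p m))) f"
    by simp
  then show ?thesis
    using weight_pos[OF m] by (simp add: integral_density integral_distr set_lebesgue_integral_def)
qed

end

section \<open>The barycentre rule on a cell away from the singularity\<close>
lemma Phi_eq_power_norm_sq:
  assumes "x \<noteq> y"
  shows "Phi t x y = (if t = 0 then ln ((norm (x - y))\<^sup>2) / 2 else (norm (x - y))\<^sup>2 powr (- t / 2))"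
proof -
  have "norm (x - y) > 0" using assms by simp
  then show ?thesis
    by (simp add: Phi_def ln_realpow powr_powr flip: powr_numeral)
qed

text \<open>Along the segment from \<open>b\<close> to \<open>x\<close>, with \<open>v = x - b\<close>, the squared distance \<open>q\<close> to \<open>\<eta>\<close> is a
  quadratic polynomial, and \<open>Phi t\<close> is a power (or half the logarithm) of \<open>q\<close>. The second
  derivative is a constant times \<open>X - (t + 2) * Y\<close>, where Cauchy-Schwarz gives \<open>0 \<le> Y \<le> X\<close>
  and \<open>X \<le> |v|^2 / R powr (t + 2)\<close>; hence it is at most \<open>(t + 1) * X\<close> in modulus before that
  constant is applied.\<close>
lemma Phi_Taylor:
  fixes S :: "'a::euclidean_space set"
  assumes S: "convex S" "b \<in> S" and far: "\<And>y. y \<in> S \<Longrightarrow> R \<le> norm (y - \<eta>)"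
    and R: "0 < R" and t: "0 \<le> t"
  obtains g where
    "\<And>x. x \<in> S \<Longrightarrow> \<bar>Phi t x \<eta> - Phi t b \<eta> - g \<bullet> (x - b)\<bar> \<le> a_const t / 2 * (norm (x - b))\<^sup>2 / R powr (t + 2)"
proof -
  \<comment> \<open>The factor \<open>c\<close> makes one formula for the derivatives serve both cases:
    \<open>c * |z| powr (-t - 2) * z\<close> is the gradient of \<open>ln |z|\<close> for \<open>t = 0\<close>
    and of \<open>|z| powr (-t)\<close> otherwise.\<close>
  define c where "c = (if t = 0 then 1 else - t)"
  define g where "g = (c * ((norm (b - \<eta>))\<^sup>2 powr (- t / 2 - 1))) *\<^sub>R (b - \<eta>)"
  have "\<bar>Phi t x \<eta> - Phi t b \<eta> - g \<bullet> (x - b)\<bar> \<le> a_const t / 2 * (norm (x - b))\<^sup>2 / R powr (t + 2)"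
    if x: "x \<in> S" for x
  proof -
    define v where "v = x - b"
    define z where "z \<tau> = b - \<eta> + \<tau> *\<^sub>R v" for \<tau>
    define q where "q \<tau> = (norm (b - \<eta>))\<^sup>2 + 2 * \<tau> * ((b - \<eta>) \<bullet> v) + \<tau>\<^sup>2 * (v \<bullet> v)" for \<tau>
    define d where "d \<tau> = (b - \<eta>) \<bullet> v + \<tau> * (v \<bullet> v)" for \<tau>
    have q_eq: "q \<tau> = (norm (z \<tau>))\<^sup>2" for \<tau>
    proof -
      have "(norm (u + \<tau> *\<^sub>R v))\<^sup>2 = (norm u)\<^sup>2 + 2 * \<tau> * (u \<bullet> v) + \<tau>\<^sup>2 * (v \<bullet> v)" for u
        unfolding power2_norm_eq_inner
        by (simp add: inner_add_left inner_add_right inner_commute power2_eq_square)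
      from this[of "b - \<eta>"] show ?thesis
        by (simp add: q_def z_def)
    qed
    have d_eq: "d \<tau> = z \<tau> \<bullet> v" for \<tau>
      by (simp add: d_def z_def inner_add_left)
    have z_far: "R \<le> norm (z \<tau>)" if "0 \<le> \<tau>" "\<tau> \<le> 1" for \<tau>
    proof -
      have "(1 - \<tau>) *\<^sub>R b + \<tau> *\<^sub>R x \<in> S"
        using S x that by (intro convexD_alt)
      moreover have "(1 - \<tau>) *\<^sub>R b + \<tau> *\<^sub>R x - \<eta> = z \<tau>"
        by (simp add: z_def v_def algebra_simps)
      ultimately show ?thesis
        using far by metis
    qed
    have q_pos: "0 < q \<tau>" if "0 \<le> \<tau>" "\<tau> \<le> 1" for \<tau>
    proof -
      have "0 < norm (z \<tau>)" using z_far[OF that] R by linarith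
      then show ?thesis by (simp add: q_eq)
    qed
    define f0 where "f0 \<tau> = (if t = 0 then ln (q \<tau>) / 2 else q \<tau> powr (- t / 2))" for \<tau>
    define f1 where "f1 \<tau> = c * (d \<tau> * q \<tau> powr (- t / 2 - 1))" for \<tau>
    define f2 where "f2 \<tau> = c * ((v \<bullet> v) * q \<tau> powr (- t / 2 - 1)
        - (t + 2) * (d \<tau>)\<^sup>2 * q \<tau> powr (- t / 2 - 2))" for \<tau>
    have dq: "(q has_real_derivative 2 * d \<tau>) (at \<tau>)" for \<tau>
      unfolding q_def d_def by (auto intro!: derivative_eq_intros simp: algebra_simps)
    have dd: "(d has_real_derivative v \<bullet> v) (at \<tau>)" for \<tau>
      unfolding d_def by (auto intro!: derivative_eq_intros)
    have df0: "(f0 has_real_derivative f1 \<tau>) (at \<tau>)" if "0 \<le> \<tau>" "\<tau> \<le> 1" for \<tau>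
    proof (cases "t = 0")
      case True
      have "((\<lambda>\<tau>. ln (q \<tau>) / 2) has_real_derivative inverse (q \<tau>) * (2 * d \<tau>) / 2) (at \<tau>)"
        by (intro DERIV_cdivide DERIV_chain2[OF DERIV_ln dq] q_pos that)
      then show ?thesis
        using q_pos[OF that] True by (simp add: f0_def[abs_def] f1_def c_def powr_minus field_simps)
    next
      case False
      have "((\<lambda>\<tau>. q \<tau> powr (- t / 2)) has_real_derivative
          - t / 2 * q \<tau> powr (- t / 2 - of_nat 1) * (2 * d \<tau>)) (at \<tau>)"
        by (intro DERIV_fun_powr dq q_pos that)
      then show ?thesis
        using False by (simp add: f0_def[abs_def] f1_def c_def field_simps)
    qed
    have df1: "(f1 has_real_derivative f2 \<tau>) (at \<tau>)" if "0 \<le> \<tau>" "\<tau> \<le> 1" for \<tau>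
    proof -
      have "((\<lambda>\<tau>. q \<tau> powr (- t / 2 - 1)) has_real_derivative
          (- t / 2 - 1) * q \<tau> powr (- t / 2 - 1 - of_nat 1) * (2 * d \<tau>)) (at \<tau>)"
        by (intro DERIV_fun_powr dq q_pos that)
      from DERIV_cmult[OF DERIV_mult[OF dd this], of c]
      have "(f1 has_real_derivative c * ((v \<bullet> v) * q \<tau> powr (- t / 2 - 1)
          + (- t / 2 - 1) * q \<tau> powr (- t / 2 - 1 - of_nat 1) * (2 * d \<tau>) * d \<tau>)) (at \<tau>)"
        by (simp add: f1_def[abs_def])
      moreover have "- t / 2 - 1 - of_nat 1 = - t / 2 - 2" by simp
      ultimately show ?thesis
        by (simp add: f2_def power2_eq_square algebra_simps)
    qed
    define diff where "diff k = (if k = 0 then f0 else if k = 1 then f1 else f2)" for k :: nat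
    have "\<exists>\<tau>. 0 < \<tau> \<and> \<tau> < 1 \<and>
        f0 1 = (\<Sum>k<2. diff k 0 / fact k * (1 - 0) ^ k) + diff 2 \<tau> / fact 2 * (1 - 0)\<^sup>2"
      by (intro Taylor_up[where a = 0]) (auto simp: diff_def less_2_cases_iff intro: df0 df1)
    then obtain \<tau> where \<tau>: "0 < \<tau>" "\<tau> < 1" "f0 1 = f0 0 + f1 0 + f2 \<tau> / 2"
      by (auto simp: diff_def numeral_2_eq_2)
    have "z 0 = b - \<eta>" "z 1 = x - \<eta>"
      by (auto simp: z_def v_def)
    moreover have "b \<noteq> \<eta>" "x \<noteq> \<eta>"
      using far[OF x] far[OF S(2)] R by auto
    ultimately have "f0 0 = Phi t b \<eta>" "f0 1 = Phi t x \<eta>" "f1 0 = g \<bullet> (x - b)"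
      by (simp_all add: Phi_eq_power_norm_sq f0_def f1_def q_eq d_eq g_def v_def)
    then have "Phi t x \<eta> - Phi t b \<eta> - g \<bullet> (x - b) = f2 \<tau> / 2"
      using \<tau>(3) by simp
    moreover have "\<bar>f2 \<tau>\<bar> \<le> a_const t * (norm (x - b))\<^sup>2 / R powr (t + 2)"
    proof -
      have \<tau>': "0 \<le> \<tau>" "\<tau> \<le> 1" using \<tau> by auto
      note pos = q_pos[OF this]
      define X where "X = (v \<bullet> v) * q \<tau> powr (- t / 2 - 1)"
      define Y where "Y = (d \<tau>)\<^sup>2 * q \<tau> powr (- t / 2 - 2)"
      have "(d \<tau>)\<^sup>2 \<le> q \<tau> * (v \<bullet> v)"
        using Cauchy_Schwarz_ineq[of "z \<tau>" v] by (simp add: d_eq q_eq power2_norm_eq_inner)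
      then have "Y \<le> q \<tau> * (v \<bullet> v) * q \<tau> powr (- t / 2 - 2)"
        by (simp add: Y_def mult_right_mono)
      also have "\<dots> = (v \<bullet> v) * (q \<tau> powr 1 * q \<tau> powr (- t / 2 - 2))"
        using pos by simp
      also have "q \<tau> powr 1 * q \<tau> powr (- t / 2 - 2) = q \<tau> powr (1 + (- t / 2 - 2))"
        by (rule powr_add[symmetric])
      also have "1 + (- t / 2 - 2) = - t / 2 - 1" by simp
      also have "(v \<bullet> v) * q \<tau> powr \<dots> = X" by (simp only: X_def)
      finally have "Y \<le> X" .
      moreover have "0 \<le> Y" by (simp add: Y_def)
      ultimately have "(t + 2) * Y \<le> (t + 2) * X" "0 \<le> (t + 2) * Y" "0 \<le> X" "0 \<le> t * X"
        using t by (auto intro!: mult_left_mono)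
      then have "\<bar>X - (t + 2) * Y\<bar> \<le> (t + 1) * X"
        by (simp add: algebra_simps abs_le_iff)
      then have "\<bar>f2 \<tau>\<bar> \<le> \<bar>c\<bar> * ((t + 1) * X)"
        by (simp add: f2_def X_def Y_def abs_mult mult.assoc mult_left_mono)
      also have "\<bar>c\<bar> * ((t + 1) * X) \<le> a_const t * X"
        using \<open>0 \<le> X\<close> t by (auto simp: c_def a_const_def abs_mult mult.assoc[symmetric] intro!: mult_right_mono mult_left_mono)
      also have "\<dots> \<le> a_const t * ((norm v)\<^sup>2 / R powr (t + 2))"
      proof (rule mult_left_mono)
        have "0 < norm (z \<tau>)" using z_far[OF \<tau>'] R by linarith
        then have "q \<tau> powr (- t / 2 - 1) = norm (z \<tau>) powr (2 * (- t / 2 - 1))"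
          by (simp add: q_eq powr_powr flip: powr_numeral)
        also have "2 * (- t / 2 - 1) = - (t + 2)" by simp
        also have "norm (z \<tau>) powr (- (t + 2)) \<le> R powr (- (t + 2))"
          using z_far[OF \<tau>'] R t by (intro powr_mono2') auto
        finally have "X \<le> (v \<bullet> v) * R powr (- (t + 2))"
          unfolding X_def by (intro mult_left_mono) auto
        then show "X \<le> (norm v)\<^sup>2 / R powr (t + 2)"
          by (simp only: powr_minus_divide power2_norm_eq_inner) simp
        show "0 \<le> a_const t" using t by (simp add: a_const_def)
      qed
      finally show ?thesis by (simp add: v_def)
    qed
    ultimately show ?thesis by simp
  qed
  then show thesis by (rule that)
qed

lemma (in finite_measure) set_integrable_bounded:
  fixes f :: "'a \<Rightarrow> 'b::{banach, second_countable_topology}"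
  assumes "A \<in> sets M" "f \<in> borel_measurable M" "\<And>x. x \<in> A \<Longrightarrow> norm (f x) \<le> B"
  shows "set_integrable M A f"
  unfolding set_integrable_def
proof (rule integrable_const_bound[of _ "max B 0"])
  show "AE x in M. norm (indicat_real A x *\<^sub>R f x) \<le> max B 0"
    using assms(3) by (intro AE_I2) (auto simp: indicator_def max.coboundedI1)
  show "(\<lambda>x. indicat_real A x *\<^sub>R f x) \<in> borel_measurable M"
    using assms by measurable
qed

lemma borel_measurable_Phi [measurable]:
  fixes \<eta> :: "'a::euclidean_space"
  shows "(\<lambda>x. Phi t x \<eta>) \<in> borel_measurable borel"
  unfolding Phi_def by measurable

lemma set_integral_inner:
  fixes f :: "_ \<Rightarrow> 'a::euclidean_space"
  assumes "set_integrable M K f"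
  shows "set_integrable M K (\<lambda>x. a \<bullet> f x)" "(LINT x:K|M. a \<bullet> f x) = a \<bullet> (LINT x:K|M. f x)"
proof -
  have *: "indicat_real K x *\<^sub>R (a \<bullet> f x) = a \<bullet> (indicat_real K x *\<^sub>R f x)" for x
    by simp
  show "set_integrable M K (\<lambda>x. a \<bullet> f x)"
    using assms unfolding set_integrable_def * by (rule integrable_inner_right)
  show "(LINT x:K|M. a \<bullet> f x) = a \<bullet> (LINT x:K|M. f x)"
    using assms unfolding set_integrable_def set_lebesgue_integral_def *
    by (intro integral_inner_right) auto
qed

text \<open>A hyperplane separating the mean from \<open>C\<close> would contradict the monotonicity of the integral of
  the separating functional.\<close>
lemma mean_in_convex:
  fixes K C :: "'a::euclidean_space set"
  assumes M: "finite_measure M" "sets M = sets borel" and K: "compact K" "0 < measure M K"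
    and C: "convex C" "closed C" "K \<subseteq> C"
  shows "(LINT x:K|M. x) /\<^sub>R measure M K \<in> C" (is "?b \<in> C")
proof (rule ccontr)
  interpret finite_measure M by fact
  note [measurable_cong] = M(2)
  have Ks [measurable]: "K \<in> sets M" using K(1) by (simp add: M(2) borel_compact)
  assume "?b \<notin> C"
  then obtain a \<beta> where a: "a \<bullet> ?b < \<beta>" "\<And>x. x \<in> C \<Longrightarrow> a \<bullet> x > \<beta>"
    using separating_hyperplane_closed_point[OF C(1,2)] by blast
  obtain B where B: "\<And>x. x \<in> K \<Longrightarrow> norm x \<le> B"
    using compact_imp_bounded[OF K(1)] by (auto simp: bounded_iff)
  have id: "set_integrable M K (\<lambda>x. x)"
    by (rule set_integrable_bounded[of _ _ B]) (use B in auto)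
  have const: "set_integrable M K (\<lambda>x. \<beta>)"
    by (rule set_integrable_bounded[of _ _ "\<bar>\<beta>\<bar>"]) auto
  have "\<beta> * measure M K = (LINT x:K|M. \<beta>)"
    by (simp add: set_lebesgue_integral_def)
  also have "\<dots> \<le> (LINT x:K|M. a \<bullet> x)"
    using a(2) C(3) by (intro set_integral_mono const set_integral_inner(1) id) (auto intro: less_imp_le)
  also have "\<dots> = a \<bullet> (LINT x:K|M. x)"
    by (rule set_integral_inner(2)[OF id])
  finally have "\<beta> \<le> a \<bullet> ?b"
    using K(2) by (simp add: field_simps)
  then show False using a(1) by simp
qed

text \<open>Expand \<open>Phi t\<close> about the barycentre \<open>b\<close>, which lies in the convex hull of \<open>K\<close>, the set on
  which the distance to \<open>\<eta>\<close> is controlled. The linear term has integral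
  zero by the choice of \<open>b\<close>, and the quadratic remainder is bounded on \<open>K\<close>.\<close>
lemma barycentre_rule_cell_error:
  fixes K :: "'a::euclidean_space set"
  assumes M: "finite_measure M" "sets M = sets borel" and K: "compact K" "0 < measure M K"
    and far: "\<And>y. y \<in> convex hull K \<Longrightarrow> R \<le> norm (y - \<eta>)" and R: "0 < R" and t: "0 \<le> t"
    and h: "\<And>x y. x \<in> K \<Longrightarrow> y \<in> K \<Longrightarrow> dist x y \<le> h"
  defines "b \<equiv> (LINT x:K|M. x) /\<^sub>R measure M K"
  shows "\<bar>(LINT x:K|M. Phi t x \<eta>) - measure M K * Phi t b \<eta>\<bar>
        \<le> a_const t / 2 * h\<^sup>2 / R powr (t + 2) * measure M K"
proof -
  interpret finite_measure M by fact
  note [measurable_cong] = M(2)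
  have Ks [measurable]: "K \<in> sets M" using K(1) by (simp add: M(2) borel_compact)
  have "b \<in> convex hull K"
    unfolding b_def using K
    by (intro mean_in_convex M convex_convex_hull compact_imp_closed compact_convex_hull hull_subset)
  then obtain g where g: "\<And>x. x \<in> convex hull K \<Longrightarrow>
      \<bar>Phi t x \<eta> - Phi t b \<eta> - g \<bullet> (x - b)\<bar> \<le> a_const t / 2 * (norm (x - b))\<^sup>2 / R powr (t + 2)"
    using Phi_Taylor[OF convex_convex_hull _ far R t] by metis
  define E where "E = a_const t / 2 * h\<^sup>2 / R powr (t + 2)"
  (* The ball about x is convex, so it contains b together with K. *)
  have x_b: "norm (x - b) \<le> h" if x: "x \<in> K" for x
  proof -
    have "convex hull K \<subseteq> cball x h"
      using h[OF x] by (intro hull_minimal) auto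
    then show ?thesis
      using \<open>b \<in> convex hull K\<close> by (auto simp: dist_norm)
  qed
  define e where "e x = Phi t x \<eta> - Phi t b \<eta> - g \<bullet> (x - b)" for x
  have e: "\<bar>e x\<bar> \<le> E" if x: "x \<in> K" for x
  proof -
    have "\<bar>e x\<bar> \<le> a_const t / 2 * (norm (x - b))\<^sup>2 / R powr (t + 2)"
      using g hull_subset[of K convex] x by (auto simp: e_def)
    also have "\<dots> \<le> E"
      unfolding E_def using x_b[OF x] t
      by (intro divide_right_mono mult_left_mono power_mono) (auto simp: a_const_def)
    finally show ?thesis .
  qed
  obtain B where B: "\<And>x. x \<in> K \<Longrightarrow> norm x \<le> B"
    using compact_imp_bounded[OF K(1)] by (auto simp: bounded_iff)
  have id: "set_integrable M K (\<lambda>x. x)"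
    by (rule set_integrable_bounded[of _ _ B]) (use B in auto)
  have const: "set_integrable M K (\<lambda>x. c)" for c :: real
    by (rule set_integrable_bounded[of _ _ "\<bar>c\<bar>"]) auto
  have [measurable]: "e \<in> borel_measurable borel"
    unfolding e_def by measurable
  have e_int: "set_integrable M K e"
    by (rule set_integrable_bounded[of _ _ E]) (use e in auto)
  define c where "c = Phi t b \<eta> - g \<bullet> b"
  have Phi_eq: "Phi t x \<eta> = e x + (c + g \<bullet> x)" for x
    by (simp add: e_def c_def inner_diff_right)
  have "(LINT x:K|M. Phi t x \<eta>) =
      (LINT x:K|M. e x) + ((LINT x:K|M. c) + g \<bullet> (LINT x:K|M. x))"
    unfolding Phi_eq
    by (simp only: set_integral_add e_int const set_integral_inner id)
  also have "(LINT x:K|M. x) = measure M K *\<^sub>R b"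
    using K(2) by (simp add: b_def)
  also have "(LINT x:K|M. c) = measure M K * (Phi t b \<eta> - g \<bullet> b)"
    by (simp add: set_lebesgue_integral_def c_def)
  finally have "(LINT x:K|M. Phi t x \<eta>) - measure M K * Phi t b \<eta> = (LINT x:K|M. e x)"
    by (simp add: algebra_simps)
  also have "\<bar>\<dots>\<bar> \<le> (LINT x:K|M. \<bar>e x\<bar>)"
    using set_integral_norm_bound[OF e_int] by simp
  also have "\<dots> \<le> (LINT x:K|M. E)"
    using e set_integrable_norm[OF e_int] by (intro set_integral_mono const) auto
  also have "\<dots> = E * measure M K"
    by (simp add: set_lebesgue_integral_def)
  finally show "\<bar>(LINT x:K|M. Phi t x \<eta>) - measure M K * Phi t b \<eta>\<bar>
      \<le> a_const t / 2 * h\<^sup>2 / R powr (t + 2) * measure M K"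
    by (simp add: E_def)
qed

section \<open>The self-similar equation for the singular integral\<close>
lemma set_integrable_of_integrable:
  fixes f :: "'a \<Rightarrow> 'b::{banach, second_countable_topology}"
  shows "A \<in> sets M \<Longrightarrow> integrable M f \<Longrightarrow> set_integrable M A f"
  unfolding set_integrable_def by (rule integrable_mult_indicator)

context self_similar_measure
begin

text \<open>The cells on which \<open>Phi t x \<eta>\<close> is regular when \<open>\<eta>\<close> is the fixed point of \<open>s m\<close>; together with
  the single large piece \<open>G [m]\<close> they partition \<open>\<Gamma>\<close> up to null sets.\<close>
definition far_cells :: "real \<Rightarrow> nat \<Rightarrow> nat list set" where
  "far_cells c m = {w \<in> cut c. hd w \<noteq> m}"

lemma finite_far_cells: "0 < c \<Longrightarrow> finite (far_cells c m)"
  by (simp add: far_cells_def finite_cut)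

lemma far_cells_word: "w \<in> far_cells c m \<Longrightarrow> set w \<subseteq> {1..M}"
  by (simp add: far_cells_def cut_def)

lemma cells_word:
  assumes "m \<in> {1..M}" "w \<in> insert [m] (far_cells c m)"
  shows "set w \<subseteq> {1..M}"
  using assms far_cells_word[of w c m] by (elim insertE) (simp, blast)

lemma component_subset_hd:
  assumes "w \<in> cut c"
  shows "hd w \<in> {1..M}" "G w \<subseteq> G [hd w]"
proof -
  obtain l v where w: "w = l # v"
    using assms by (cases w) (auto simp: cut_def)
  then show "hd w \<in> {1..M}" "G w \<subseteq> G [hd w]"
    using assms component_append_subset[of v "[l]"] by (auto simp: cut_def)
qed

lemma \<Gamma>_eq_far_cells:
  assumes m: "m \<in> {1..M}" and c: "0 < c" "c < 1"
  shows "\<Gamma> = (\<Union>w\<in>insert [m] (far_cells c m). G w)"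
proof
  show "(\<Union>w\<in>insert [m] (far_cells c m). G w) \<subseteq> \<Gamma>"
    using cells_word[OF m] by (intro UN_least component_subset)
  show "\<Gamma> \<subseteq> (\<Union>w\<in>insert [m] (far_cells c m). G w)"
  proof
    fix x assume "x \<in> \<Gamma>"
    then obtain v where v: "v \<in> cut c" "x \<in> G v"
      using ex_cut_extension[of x "[]" c] c by auto
    then show "x \<in> (\<Union>w\<in>insert [m] (far_cells c m). G w)"
      using component_subset_hd[OF v(1)] by (cases "hd v = m") (auto simp: far_cells_def)
  qed
qed

lemma AE_far_cells_disjoint:
  assumes m: "m \<in> {1..M}" and uv: "u \<in> insert [m] (far_cells c m)" "v \<in> insert [m] (far_cells c m)"
  shows "AE x in \<mu>. x \<in> G u \<and> x \<in> G v \<longrightarrow> u = v"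
proof (cases "u = v")
  case False
  have meas: "G w \<in> sets borel" if "w \<in> insert [m] (far_cells c m)" for w
    using cells_word[OF m that] by (rule borel_component)
  have near: "measure \<mu> (G [m] \<inter> G w) = 0" if w: "w \<in> far_cells c m" for w
  proof -
    have "w \<in> cut c" "hd w \<noteq> m" using w by (auto simp: far_cells_def)
    note hd = component_subset_hd[OF this(1)] this(2)
    have "measure \<mu> (G [m] \<inter> G w) \<le> measure \<mu> (G [m] \<inter> G [hd w])"
      using hd m by (intro finite_measure_mono) (auto intro!: sets.Int borel_component)
    then show ?thesis
      using measure_letter_overlap[OF m hd(1)] hd(3) by (simp add: measure_le_0_iff)
  qed
  have "measure \<mu> (G u \<inter> G v) = 0"
  proof (cases "u = [m] \<or> v = [m]")
    case True
    then show ?thesis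
      using uv False near[of u] near[of v] by (auto simp: Int_commute)
  next
    case False
    then show ?thesis
      using uv \<open>u \<noteq> v\<close> by (intro measure_cut_overlap) (auto simp: far_cells_def)
  qed
  then have "G u \<inter> G v \<in> null_sets \<mu>"
    using meas uv by (intro null_setsI) (auto simp: emeasure_eq_measure)
  then show ?thesis
    by (rule AE_I') (use False in auto)
qed simp

lemma set_integral_\<Gamma>:
  fixes f :: "real^'n \<Rightarrow> real"
  assumes "f \<in> borel_measurable borel"
  shows "(LINT x:\<Gamma>|\<mu>. f x) = (LINT x|\<mu>. f x)"
  unfolding set_lebesgue_integral_def
  using assms by (intro integral_cong_AE) (auto intro: AE_mp[OF AE_\<Gamma>])

lemma integral_self_similar:
  fixes f :: "real^'n \<Rightarrow> real"
  assumes m: "m \<in> {1..M}" and c: "0 < c" "c < 1"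
    and f: "f \<in> borel_measurable borel" "integrable \<mu> f"
  shows "(LINT x|\<mu>. f x) = p m * (LINT x|\<mu>. f (s m x)) + (\<Sum>w\<in>far_cells c m. LINT x:G w|\<mu>. f x)"
proof -
  have meas: "G w \<in> sets borel" if "w \<in> insert [m] (far_cells c m)" for w
    using cells_word[OF m that] by (rule borel_component)
  have "(LINT x|\<mu>. f x) = (LINT x:\<Gamma>|\<mu>. f x)"
    using f by (simp add: set_integral_\<Gamma>)
  also have "\<dots> = (LINT x:(\<Union>w\<in>insert [m] (far_cells c m). G w)|\<mu>. f x)"
    by (simp only: \<Gamma>_eq_far_cells[OF m c, symmetric])
  also have "\<dots> = (\<Sum>w\<in>insert [m] (far_cells c m). LINT x:G w|\<mu>. f x)"
  proof (rule set_integral_finite_UN_AE)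
    show "finite (insert [m] (far_cells c m))"
      using c by (simp add: finite_far_cells)
    show "AE x in \<mu>. x \<in> G u \<and> x \<in> G v \<longrightarrow> u = v"
      if "u \<in> insert [m] (far_cells c m)" "v \<in> insert [m] (far_cells c m)" for u v
      using m that by (rule AE_far_cells_disjoint)
    show "G w \<in> sets \<mu>" "set_integrable \<mu> (G w) f" if "w \<in> insert [m] (far_cells c m)" for w
      using meas[OF that] f(2) by (simp_all add: set_integrable_of_integrable)
  qed
  also have "\<dots> = (LINT x:G [m]|\<mu>. f x) + (\<Sum>w\<in>far_cells c m. LINT x:G w|\<mu>. f x)"
    using finite_far_cells[OF c(1)] by (intro sum.insert) (auto simp: far_cells_def)
  finally show ?thesis
    using set_integral_letter[OF m f(1)] by simp
qed

lemma sum_measure_far_cells_le: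
  assumes m: "m \<in> {1..M}" and c: "0 < c" "c < 1"
  shows "(\<Sum>w\<in>far_cells c m. measure \<mu> (G w)) \<le> measure \<mu> \<Gamma>"
proof -
  have "(LINT x|\<mu>. 1) = p m * (LINT x|\<mu>. 1) + (\<Sum>w\<in>far_cells c m. LINT x:G w|\<mu>. 1)"
    using m c by (intro integral_self_similar) auto
  moreover have "0 \<le> p m * (LINT x|\<mu>. 1)"
    using weight_pos[OF m] by simp
  moreover have "(LINT x|\<mu>. 1) = measure \<mu> \<Gamma>"
    using set_integral_\<Gamma>[of "\<lambda>_. 1"] by (simp add: set_lebesgue_integral_def)
  moreover have "(\<Sum>w\<in>far_cells c m. LINT x:G w|\<mu>. 1) = (\<Sum>w\<in>far_cells c m. measure \<mu> (G w))"
    by (simp add: set_lebesgue_integral_def)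
  ultimately show ?thesis by linarith
qed

lemma norm_s_minus_fixed_point:
  assumes "m \<in> {1..M}" "s m \<eta> = \<eta>"
  shows "norm (s m x - \<eta>) = \<rho> m * norm (x - \<eta>)"
  using dist_s[OF assms(1), of x \<eta>] assms(2) by (simp add: dist_norm)

lemma Phi_s:
  assumes "m \<in> {1..M}" "s m \<eta> = \<eta>" "t \<noteq> 0"
  shows "Phi t (s m x) \<eta> = \<rho> m powr (- t) * Phi t x \<eta>"
  using assms by (simp add: Phi_def norm_s_minus_fixed_point powr_mult)

text \<open>Invariance gives \<open>\<mu> {\<eta>} = p m * \<mu> {\<eta>}\<close>. The logarithmic case needs this: the
  shift by \<open>ln (\<rho> m)\<close> fails at \<open>\<eta>\<close>, where \<open>Phi 0\<close> takes the default value 0.\<close>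
lemma measure_fixed_point:
  assumes m: "m \<in> {1..M}" and \<eta>: "\<eta> \<in> \<Gamma>" "s m \<eta> = \<eta>"
  shows "measure \<mu> {\<eta>} = 0"
proof -
  have "\<eta> \<in> G [m]"
    using \<eta> by (force simp: component_Cons)
  moreover have "s m -` {\<eta>} = {\<eta>}"
    using \<eta>(2) inj_s[OF m] by (auto simp: inj_def)
  ultimately have "measure \<mu> {\<eta>} = p m * measure \<mu> {\<eta>}"
    using measure_Int_letter[OF m, of "{\<eta>}"] by simp
  then show ?thesis
    using weight_less_1[OF m] by simp
qed

text \<open>The equation for \<open>I\<close> also holds when both sides are infinite, so it is applied to the
  truncations \<open>f N = min (Phi t) N\<close>. As \<open>a = \<rho> m powr (-t) \<ge> 1\<close>, truncation
  satisfies \<open>min (a * Phi t) N \<le> a * min (Phi t) N\<close>, and the resulting inequality bounds the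
  integrals uniformly in \<open>N\<close>; monotone convergence concludes.\<close>
lemma integrable_Phi_pos:
  assumes m: "m \<in> {1..M}" and c: "0 < c" "c < 1" and \<eta>: "s m \<eta> = \<eta>"
    and far: "\<And>w x. w \<in> far_cells c m \<Longrightarrow> x \<in> G w \<Longrightarrow> R \<le> norm (x - \<eta>)" and R: "0 < R"
    and t: "0 < t" "p m * \<rho> m powr (- t) < 1"
  shows "integrable \<mu> (\<lambda>x. Phi t x \<eta>)"
proof -
  define f where "f N x = min (Phi t x \<eta>) (real N)" for N x
  define a where "a = \<rho> m powr (- t)"
  define C where "C = (\<Sum>w\<in>far_cells c m. R powr (- t) * measure \<mu> (G w))"
  have a: "1 \<le> a"
    using powr_mono'[of "- t" 0 "\<rho> m"] t ratio_pos[OF m] ratio_less_1[OF m] by (simp add: a_def)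
  have Phi_nonneg: "0 \<le> Phi t x \<eta>" for x
    using t by (simp add: Phi_def)
  have [measurable]: "f N \<in> borel_measurable borel" for N
    unfolding f_def by measurable
  have [measurable]: "s m \<in> borel_measurable borel"
    using m by (rule measurable_s)
  have f_bounds: "0 \<le> f N x" "f N x \<le> real N" for N x
    using Phi_nonneg by (auto simp: f_def)
  have f_int: "integrable \<mu> (f N)" for N
    using f_bounds by (intro integrable_const_bound[of _ "real N"]) auto
  have fs_int: "integrable \<mu> (\<lambda>x. f N (s m x))" for N
    using f_bounds by (intro integrable_const_bound[of _ "real N"]) auto
  have bound: "(LINT x|\<mu>. f N x) \<le> C / (1 - p m * a)" for N
  proof -
    have "f N (s m x) \<le> a * f N x" for x
    proof -
      have "real N \<le> a * real N" using a by (simp add: mult_le_cancel_right1)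
      then show ?thesis
        using a t by (simp add: f_def Phi_s[OF m \<eta>] flip: a_def)
    qed
    then have "(LINT x|\<mu>. f N (s m x)) \<le> (LINT x|\<mu>. a * f N x)"
      by (intro integral_mono fs_int integrable_mult_right f_int)
    then have 1: "p m * (LINT x|\<mu>. f N (s m x)) \<le> p m * (a * (LINT x|\<mu>. f N x))"
      using weight_pos[OF m] by simp
    have 2: "(LINT x:G w|\<mu>. f N x) \<le> R powr (- t) * measure \<mu> (G w)" if w: "w \<in> far_cells c m" for w
    proof -
      have meas: "G w \<in> sets \<mu>" using far_cells_word[OF w] by (simp add: borel_component)
      have "f N x \<le> R powr (- t)" if "x \<in> G w" for x
      proof -
        have "norm (x - \<eta>) powr (- t) \<le> R powr (- t)"
          using far[OF w that] R t by (intro powr_mono2') auto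
        then show ?thesis using t by (simp add: f_def Phi_def)
      qed
      then have "(LINT x:G w|\<mu>. f N x) \<le> (LINT x:G w|\<mu>. R powr (- t))"
        using meas f_int by (intro set_integral_mono set_integrable_of_integrable) auto
      also have "\<dots> = R powr (- t) * measure \<mu> (G w)"
        by (simp add: set_lebesgue_integral_def)
      finally show ?thesis .
    qed
    have "(LINT x|\<mu>. f N x) = p m * (LINT x|\<mu>. f N (s m x)) + (\<Sum>w\<in>far_cells c m. LINT x:G w|\<mu>. f N x)"
      by (intro integral_self_similar m c f_int) simp
    also have "\<dots> \<le> p m * (a * (LINT x|\<mu>. f N x)) + C"
      unfolding C_def by (intro add_mono 1 sum_mono 2)
    finally have "(LINT x|\<mu>. f N x) * (1 - p m * a) \<le> C"
      by (simp add: algebra_simps)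
    then show ?thesis
      using t by (simp add: a_def pos_le_divide_eq)
  qed
  have "incseq (\<lambda>N. LINT x|\<mu>. f N x)"
    by (intro incseq_SucI integral_mono f_int) (auto simp: f_def)
  then obtain L where L: "(\<lambda>N. LINT x|\<mu>. f N x) \<longlonglongrightarrow> L"
    using bound by (metis incseq_convergent)
  have "eventually (\<lambda>N. f N x = Phi t x \<eta>) sequentially" for x
    using eventually_ge_at_top[of "nat \<lceil>Phi t x \<eta>\<rceil>"]
    by eventually_elim (auto simp: f_def min_def)
  then have "(\<lambda>N. f N x) \<longlonglongrightarrow> Phi t x \<eta>" for x
    by (rule tendsto_eventually)
  then show ?thesis
    by (intro integrable_monotone_convergence[OF f_int _ _ L]) (auto simp: f_def intro!: monoI)
qed

text \<open>The bound on \<open>t\<close> says exactly that \<open>p m * \<rho> m powr (-t) < 1\<close>. The logarithm is dominated by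
  \<open>d powr (-u) / u + d\<close> for any positive \<open>u\<close>; half the critical exponent is a
  \<open>u\<close> to which the case of positive exponents applies.\<close>
lemma integrable_Phi:
  assumes m: "m \<in> {1..M}" and c: "0 < c" "c < 1" and \<eta>: "s m \<eta> = \<eta>"
    and far: "\<And>w x. w \<in> far_cells c m \<Longrightarrow> x \<in> G w \<Longrightarrow> R \<le> norm (x - \<eta>)" and R: "0 < R"
    and t: "0 \<le> t" "t < ln (p m) / ln (\<rho> m)"
  shows "p m * \<rho> m powr (- t) < 1" "integrable \<mu> (\<lambda>x. Phi t x \<eta>)"
proof -
  have sub: "p m * \<rho> m powr (- u) < 1" if "u < ln (p m) / ln (\<rho> m)" for u
  proof -
    have "ln (\<rho> m) < 0"
      using ratio_pos[OF m] ratio_less_1[OF m] by simp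
    then have "ln (p m) < u * ln (\<rho> m)"
      using that by (simp add: neg_less_divide_eq)
    then have "p m < exp (u * ln (\<rho> m))"
      using weight_pos[OF m] by (metis exp_less_mono exp_ln)
    then have "p m < \<rho> m powr u"
      using ratio_pos[OF m] by (simp add: powr_def)
    then show ?thesis
      using ratio_pos[OF m] by (simp add: powr_minus field_simps)
  qed
  show "p m * \<rho> m powr (- t) < 1" using t(2) by (rule sub)
  show "integrable \<mu> (\<lambda>x. Phi t x \<eta>)"
  proof (cases "t = 0")
    case False
    then show ?thesis
      using t by (intro integrable_Phi_pos[OF m c \<eta> far R _ sub]) auto
  next
    case True
    define u where "u = ln (p m) / ln (\<rho> m) / 2"
    have u: "0 < u" "u < ln (p m) / ln (\<rho> m)"
      using t True by (auto simp: u_def)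
    obtain B where B: "\<And>x. x \<in> \<Gamma> \<Longrightarrow> norm (x - \<eta>) \<le> B"
      using compact_imp_bounded[OF \<Gamma>_compact] bounded_any_center[of \<Gamma> \<eta>]
      by (metis dist_commute dist_norm)
    have "integrable \<mu> (\<lambda>x. Phi u x \<eta>)"
      using far R u(1) sub[OF u(2)] by (rule integrable_Phi_pos[OF m c \<eta>])
    moreover have "integrable \<mu> (\<lambda>x. norm (x - \<eta>))"
      by (rule integrable_const_bound[of _ B]) (auto intro: AE_mp[OF AE_\<Gamma>] B)
    ultimately have "integrable \<mu> (\<lambda>x. Phi u x \<eta> / u + norm (x - \<eta>))"
      by simp
    moreover have "norm (Phi t x \<eta>) \<le> norm (Phi u x \<eta> / u + norm (x - \<eta>))" for x
    proof (cases "x = \<eta>")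
      case False
      define d where "d = norm (x - \<eta>)"
      have d: "0 < d" using False by (simp add: d_def)
      have "ln d \<le> d" using ln_bound[OF d] .
      moreover have "ln (d powr (- u)) \<le> d powr (- u)"
        using d by (intro ln_bound) simp
      then have "- ln d \<le> d powr (- u) / u"
        using d u by (simp add: ln_powr pos_le_divide_eq mult.commute)
      moreover have "0 \<le> d powr (- u) / u" using u by simp
      ultimately have "\<bar>ln d\<bar> \<le> d powr (- u) / u + d"
        using d by linarith
      then show ?thesis
        using True u by (simp add: Phi_def flip: d_def)
    qed (simp add: Phi_def True)
    ultimately show ?thesis
      by (elim Bochner_Integration.integrable_bound) auto
  qed
qed

lemma integral_Phi_eq:
  assumes m: "m \<in> {1..M}" and c: "0 < c" "c < 1" and \<eta>: "\<eta> \<in> \<Gamma>" "s m \<eta> = \<eta>"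
    and int: "integrable \<mu> (\<lambda>x. Phi t x \<eta>)" and less: "p m * \<rho> m powr (- t) < 1"
  shows "(LINT x|\<mu>. Phi t x \<eta>) =
    ((if t = 0 then p m * measure \<mu> \<Gamma> * ln (\<rho> m) else 0) +
      (\<Sum>w\<in>far_cells c m. LINT x:G w|\<mu>. Phi t x \<eta>)) / (1 - p m * \<rho> m powr (- t))"
proof -
  have meas_s [measurable]: "s m \<in> borel_measurable borel"
    using m by (rule measurable_s)
  define A where "A = (if t = 0 then measure \<mu> \<Gamma> * ln (\<rho> m) else 0)"
  define S where "S = (\<Sum>w\<in>far_cells c m. LINT x:G w|\<mu>. Phi t x \<eta>)"
  have "(LINT x|\<mu>. Phi t (s m x) \<eta>) = A + \<rho> m powr (- t) * (LINT x|\<mu>. Phi t x \<eta>)"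
  proof (cases "t = 0")
    case True
    have "{\<eta>} \<in> null_sets \<mu>"
      using measure_fixed_point[OF m \<eta>] by (intro null_setsI) (auto simp: emeasure_eq_measure)
    then have "AE x in \<mu>. x \<noteq> \<eta>"
      by (rule AE_I') auto
    moreover have "Phi t (s m x) \<eta> = ln (\<rho> m) + Phi t x \<eta>" if "x \<noteq> \<eta>" for x
      using that True ratio_pos[OF m] by (simp add: Phi_def norm_s_minus_fixed_point[OF m \<eta>(2)] ln_mult)
    ultimately have "(LINT x|\<mu>. Phi t (s m x) \<eta>) = (LINT x|\<mu>. ln (\<rho> m) + Phi t x \<eta>)"
      by (intro integral_cong_AE) (auto elim!: eventually_mono)
    also have "\<dots> = measure \<mu> \<Gamma> * ln (\<rho> m) + (LINT x|\<mu>. Phi t x \<eta>)"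
      using int set_integral_\<Gamma>[of "\<lambda>_. 1"] by (simp add: set_lebesgue_integral_def)
    finally show ?thesis
      using True ratio_pos[OF m] by (simp add: A_def)
  next
    case False
    then show ?thesis
      by (simp add: A_def Phi_s[OF m \<eta>(2)])
  qed
  moreover have "(LINT x|\<mu>. Phi t x \<eta>) =
      p m * (LINT x|\<mu>. Phi t (s m x) \<eta>) + (\<Sum>w\<in>far_cells c m. LINT x:G w|\<mu>. Phi t x \<eta>)"
    by (rule integral_self_similar[OF m c _ int]) simp
  ultimately have eq: "(LINT x|\<mu>. Phi t x \<eta>) = p m * (A + \<rho> m powr (- t) * (LINT x|\<mu>. Phi t x \<eta>)) + S"
    by (simp only: S_def)
  have "(LINT x|\<mu>. Phi t x \<eta>) * (1 - p m * \<rho> m powr (- t)) =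
      (LINT x|\<mu>. Phi t x \<eta>) - p m * (A + \<rho> m powr (- t) * (LINT x|\<mu>. Phi t x \<eta>)) + p m * A"
    by (simp only: ring_distribs mult.assoc mult.commute mult.left_commute)
  also have "\<dots> = p m * A + S"
    using eq by linarith
  finally show ?thesis
    using less by (simp add: eq_divide_eq A_def S_def)
qed

end

section \<open>The error of the quadrature rule\<close>

context self_similar_set
begin

lemma diameter_component_le_iff:
  assumes "set w \<subseteq> {1..M}" "0 < diameter \<Gamma>"
  shows "diameter (G w) \<le> h \<longleftrightarrow> r w \<le> h / diameter \<Gamma>"
  using assms by (simp add: diameter_component[OF assms(1)] pos_le_divide_eq)

lemma L_index_Nil:
  assumes "0 < h" "h < diameter \<Gamma>"
  shows "L_index M s \<Gamma> [] h = cut (h / diameter \<Gamma>)"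
proof -
  have diam: "0 < diameter \<Gamma>" using assms by linarith
  have "set (butlast w) \<subseteq> {1..M}" if "set w \<subseteq> {1..M}" for w
    using that by (auto dest: in_set_butlastD)
  then have "w \<in> L_index M s \<Gamma> [] h \<longleftrightarrow> w \<in> cut (h / diameter \<Gamma>)" for w
    using assms diameter_component_le_iff[OF _ diam, of w h]
      diameter_component_le_iff[OF _ diam, of "butlast w" h]
    by (auto simp: L_index_def cut_def not_le[symmetric])
  then show ?thesis by blast
qed

text \<open>Relative to the prefix \<open>l\<close>, the index set of the piece \<open>l\<close> consists of the words of the stopping
  set that begin with \<open>l\<close>. A piece already of diameter at most \<open>h\<close> is indexed by the empty word
  on the left and by the one-letter word \<open>[l]\<close> on the right.\<close>
lemma L_index_letter:
  assumes "0 < h" "h < diameter \<Gamma>" and l: "l \<in> {1..M}"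
  shows "v \<in> L_index M s \<Gamma> [l] h \<longleftrightarrow> l # v \<in> cut (h / diameter \<Gamma>)"
proof -
  have diam: "0 < diameter \<Gamma>" using assms by linarith
  have c: "h / diameter \<Gamma> < 1" using assms diam by simp
  have iff: "diameter (G w) \<le> h \<longleftrightarrow> r w \<le> h / diameter \<Gamma>" if "set w \<subseteq> {1..M}" for w
    using that diam by (rule diameter_component_le_iff)
  have letter: "diameter (G [l]) \<le> h \<longleftrightarrow> \<rho> l \<le> h / diameter \<Gamma>"
    using iff[of "[l]"] l by simp
  show ?thesis
  proof (cases "diameter (G [l]) \<le> h")
    case True
    have "v = []" if "l # v \<in> cut (h / diameter \<Gamma>)"
    proof (rule ccontr)
      assume "v \<noteq> []"
      have "set (butlast v) \<subseteq> {1..M}"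
        using that by (auto simp: cut_def dest: in_set_butlastD)
      then have "r (butlast v) \<le> 1"
        using word_ratio_le_power[of 1 "butlast v"] by (simp add: less_imp_le ratio_less_1)
      then have "\<rho> l * r (butlast v) \<le> \<rho> l"
        using ratio_pos[OF l] by (intro mult_left_le) auto
      then show False
        using that \<open>v \<noteq> []\<close> True letter by (simp add: cut_def)
    qed
    moreover have "[l] \<in> cut (h / diameter \<Gamma>)"
      using True letter c l by (simp add: cut_def)
    ultimately show ?thesis
      using True by (auto simp: L_index_def)
  next
    case False
    have "set (butlast w) \<subseteq> {1..M}" if "set w \<subseteq> {1..M}" for w
      using that by (auto dest: in_set_butlastD)
    then show ?thesis
      using False letter l iff[of "l # v"] iff[of "l # butlast v"]
      by (cases "v = []") (auto simp: L_index_def cut_def not_le[symmetric])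
  qed
qed

lemma sum_L_index_letters:
  fixes F :: "nat list \<Rightarrow> real"
  assumes "0 < h" "h < diameter \<Gamma>"
  shows "(\<Sum>l\<in>{1..M} - {m}. \<Sum>v\<in>L_index M s \<Gamma> [l] h. F (l # v))
    = (\<Sum>w | w \<in> cut (h / diameter \<Gamma>) \<and> hd w \<noteq> m. F w)"
proof -
  have "0 < diameter \<Gamma>" using assms by linarith
  then have fin: "finite (cut (h / diameter \<Gamma>))"
    using assms by (intro finite_cut) simp
  have "finite (L_index M s \<Gamma> [l] h)" if l: "l \<in> {1..M}" for l
  proof (rule inj_on_finite[OF _ _ fin])
    show "(#) l ` L_index M s \<Gamma> [l] h \<subseteq> cut (h / diameter \<Gamma>)"
      using L_index_letter[OF assms l] by auto
  qed simp
  then have "(\<Sum>l\<in>{1..M} - {m}. \<Sum>v\<in>L_index M s \<Gamma> [l] h. F (l # v))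
      = (\<Sum>(l, v)\<in>(SIGMA l:{1..M} - {m}. L_index M s \<Gamma> [l] h). F (l # v))"
    by (intro sum.Sigma) auto
  also have "\<dots> = (\<Sum>w | w \<in> cut (h / diameter \<Gamma>) \<and> hd w \<noteq> m. F w)"
  proof (rule sum.reindex_bij_witness[of _ "\<lambda>w. (hd w, tl w)" "\<lambda>(l, v). l # v"])
    fix w assume "w \<in> {w. w \<in> cut (h / diameter \<Gamma>) \<and> hd w \<noteq> m}"
    moreover from this obtain l v where "w = l # v"
      by (cases w) (auto simp: cut_def)
    ultimately show "(hd w, tl w) \<in> (SIGMA l:{1..M} - {m}. L_index M s \<Gamma> [l] h)"
      using L_index_letter[OF assms, of l v] by (auto simp: cut_def)
  next
    fix w assume "w \<in> {w. w \<in> cut (h / diameter \<Gamma>) \<and> hd w \<noteq> m}"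
    then show "(case (hd w, tl w) of (l, v) \<Rightarrow> l # v) = w"
      by (auto simp: cut_def)
  qed (use L_index_letter[OF assms] in auto)
  finally show ?thesis .
qed

end

context self_similar_measure
begin

lemma singular_rule_eq:
  assumes m: "m \<in> {1..M}" and h: "0 < h" "h < diameter \<Gamma>"
  shows "singular_rule M \<rho> s p \<Gamma> \<mu> h t m \<eta> =
    ((if t = 0 then p m * measure \<mu> \<Gamma> * ln (\<rho> m) else 0) +
      (\<Sum>w\<in>far_cells (h / diameter \<Gamma>) m. measure \<mu> (G w) * Phi t (barycentre s \<Gamma> \<mu> w) \<eta>))
    / (1 - p m * \<rho> m powr (- t))"
proof -
  have "(\<Sum>m'\<in>{1..M} - {m}. barycentre_rule M s \<Gamma> \<mu> [m'] h (\<lambda>x. Phi t x \<eta>)) =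
      (\<Sum>w\<in>far_cells (h / diameter \<Gamma>) m. measure \<mu> (G w) * Phi t (barycentre s \<Gamma> \<mu> w) \<eta>)"
    unfolding far_cells_def sum_L_index_letters[OF h, symmetric] barycentre_rule_def by simp
  then show ?thesis
    using ratio_pos[OF m] by (cases "t = 0") (simp_all add: singular_rule_def)
qed

text \<open>The rule solves the same linear equation as the integral, with the integrals over the far
  cells replaced by their barycentre values. Hence the cell errors are just summed and divided by
  \<open>1 - p m * \<rho> m powr (-t)\<close>.\<close>
lemma singular_rule_error:
  assumes m: "m \<in> {1..M}" and h: "0 < h" "h < diameter \<Gamma>" and \<eta>: "\<eta> \<in> \<Gamma>" "s m \<eta> = \<eta>"
    and R: "0 < R"
    and far: "\<And>w y. w \<in> far_cells (h / diameter \<Gamma>) m \<Longrightarrow> y \<in> convex hull G w \<Longrightarrow> R \<le> norm (y - \<eta>)"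
    and t: "0 \<le> t" "t < ln (p m) / ln (\<rho> m)"
  shows "set_integrable \<mu> \<Gamma> (\<lambda>x. Phi t x \<eta>)"
    and "\<bar>(LINT x:\<Gamma>|\<mu>. Phi t x \<eta>) - singular_rule M \<rho> s p \<Gamma> \<mu> h t m \<eta>\<bar>
      \<le> (a_const t * h\<^sup>2 * measure \<mu> \<Gamma>) / (2 * (1 - p m * \<rho> m powr (- t)) * R powr (t + 2))"
proof -
  define c where "c = h / diameter \<Gamma>"
  have "0 < diameter \<Gamma>" using h by linarith
  then have c: "0 < c" "c < 1" using h by (auto simp: c_def)
  have far_cell: "R \<le> norm (x - \<eta>)" if "w \<in> far_cells c m" "x \<in> G w" for w x
    using far[of w x] that hull_subset[of "G w" convex] by (auto simp: c_def)
  note int = integrable_Phi[OF m c \<eta>(2) far_cell R t]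
  show "set_integrable \<mu> \<Gamma> (\<lambda>x. Phi t x \<eta>)"
    using int(2) by (intro set_integrable_of_integrable) auto
  define D where "D = 1 - p m * \<rho> m powr (- t)"
  define A where "A = (if t = 0 then p m * measure \<mu> \<Gamma> * ln (\<rho> m) else 0)"
  have D: "0 < D" using int(1) by (simp add: D_def)
  define E where "E = a_const t / 2 * h\<^sup>2 / R powr (t + 2)"
  have E: "0 \<le> E" using t by (simp add: E_def a_const_def)
  define e where "e w = (LINT x:G w|\<mu>. Phi t x \<eta>) - measure \<mu> (G w) * Phi t (barycentre s \<Gamma> \<mu> w) \<eta>" for w
  have cell: "\<bar>e w\<bar> \<le> E * measure \<mu> (G w)" if w: "w \<in> far_cells c m" for w
    unfolding e_def E_def barycentre_def
  proof (rule barycentre_rule_cell_error[OF finite_measure_axioms sets_\<mu> _ _ _ R t(1)])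
    have word: "set w \<subseteq> {1..M}" using w by (rule far_cells_word)
    show "compact (G w)" using word by (rule component_compact)
    show "0 < measure \<mu> (G w)" using word by (rule measure_component_pos)
    show "R \<le> norm (y - \<eta>)" if "y \<in> convex hull G w" for y
      using far w that by (simp add: c_def)
    have "diameter (G w) \<le> h"
      using w diameter_component_le_iff[OF word \<open>0 < diameter \<Gamma>\<close>] by (simp add: far_cells_def cut_def c_def)
    then show "dist x y \<le> h" if "x \<in> G w" "y \<in> G w" for x y
      using diameter_bounded_bound[OF compact_imp_bounded[OF component_compact[OF word]] that] by linarith
  qed
  have "(LINT x:\<Gamma>|\<mu>. Phi t x \<eta>) = (LINT x|\<mu>. Phi t x \<eta>)"
    by (rule set_integral_\<Gamma>) simp
  also have "\<dots> = (A + (\<Sum>w\<in>far_cells c m. LINT x:G w|\<mu>. Phi t x \<eta>)) / D"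
    unfolding A_def D_def by (rule integral_Phi_eq[OF m c \<eta> int(2,1)])
  finally have I_eq: "(LINT x:\<Gamma>|\<mu>. Phi t x \<eta>) =
      (A + (\<Sum>w\<in>far_cells c m. LINT x:G w|\<mu>. Phi t x \<eta>)) / D" .
  have Q_eq: "singular_rule M \<rho> s p \<Gamma> \<mu> h t m \<eta> =
      (A + (\<Sum>w\<in>far_cells c m. measure \<mu> (G w) * Phi t (barycentre s \<Gamma> \<mu> w) \<eta>)) / D"
    unfolding A_def D_def c_def by (rule singular_rule_eq[OF m h])
  have "(LINT x:\<Gamma>|\<mu>. Phi t x \<eta>) - singular_rule M \<rho> s p \<Gamma> \<mu> h t m \<eta> =
      (\<Sum>w\<in>far_cells c m. e w) / D"
    unfolding I_eq Q_eq by (simp add: e_def sum_subtractf diff_divide_distrib[symmetric])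
  then have "\<bar>(LINT x:\<Gamma>|\<mu>. Phi t x \<eta>) - singular_rule M \<rho> s p \<Gamma> \<mu> h t m \<eta>\<bar> =
      \<bar>\<Sum>w\<in>far_cells c m. e w\<bar> / D"
    using D by simp
  also have "\<dots> \<le> (\<Sum>w\<in>far_cells c m. E * measure \<mu> (G w)) / D"
    using D cell by (intro divide_right_mono order_trans[OF sum_abs] sum_mono) auto
  also have "\<dots> \<le> E * measure \<mu> \<Gamma> / D"
    using D E sum_measure_far_cells_le[OF m c]
    by (intro divide_right_mono) (auto simp flip: sum_distrib_left intro: mult_left_mono)
  also have "\<dots> = (a_const t * h\<^sup>2 * measure \<mu> \<Gamma>) / (2 * D * R powr (t + 2))"
    by (simp add: E_def)
  finally show "\<bar>(LINT x:\<Gamma>|\<mu>. Phi t x \<eta>) - singular_rule M \<rho> s p \<Gamma> \<mu> h t m \<eta>\<bar>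
      \<le> (a_const t * h\<^sup>2 * measure \<mu> \<Gamma>) / (2 * (1 - p m * \<rho> m powr (- t)) * R powr (t + 2))"
    by (simp only: D_def)
qed

end

lemma norm_orthogonal_matrix_mult:
  fixes A :: "real^'n^'n"
  assumes "orthogonal_matrix A"
  shows "norm (A *v x) = norm x"
proof -
  have "orthogonal_transformation ((*v) A)"
    using assms by (simp add: orthogonal_transformation_matrix)
  then show ?thesis
    by (rule orthogonal_transformation_norm)
qed

lemma similarity_ifs_dist:
  assumes "similarity_ifs M \<rho> s" "l \<in> {1..M}"
  shows "dist (s l x) (s l y) = \<rho> l * dist x y"
proof -
  obtain A \<delta> where A: "orthogonal_matrix A" "\<And>x. s l x = \<rho> l *\<^sub>R (A *v x) + \<delta>" and "0 < \<rho> l"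
    using assms unfolding similarity_ifs_def by blast
  have "s l x - s l y = \<rho> l *\<^sub>R (A *v (x - y))"
    by (simp add: A(2) matrix_vector_mult_diff_distrib scaleR_diff_right)
  then show ?thesis
    using \<open>0 < \<rho> l\<close> A(1) by (simp add: dist_norm norm_orthogonal_matrix_mult)
qed

theorem corollary4p4:
  fixes M m :: nat
    and \<rho> p :: "nat \<Rightarrow> real"
    and s :: "nat \<Rightarrow> real^'n \<Rightarrow> real^'n"
    and \<Gamma> :: "(real^'n) set"
    and \<mu> :: "(real^'n) measure"
    and \<eta> :: "real^'n"
    and h :: real
  assumes "similarity_ifs M \<rho> s"
    and "open_set_condition M s"
    and "is_attractor M s \<Gamma>"
    and "invariant_measure M s p \<Gamma> \<mu>"
    and "m \<in> {1..M}"
    and "\<eta> \<in> \<Gamma>" and "s m \<eta> = \<eta>"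
    and "\<forall>m'\<in>{1..M}. m' \<noteq> m \<longrightarrow> \<eta> \<notin> component s \<Gamma> [m']"
    and "0 < h" and "h < diameter \<Gamma>"
    and "\<forall>ks\<in>L_index M s \<Gamma> [] h. hd ks \<noteq> m \<longrightarrow> \<eta> \<notin> convex hull component s \<Gamma> ks"
  shows "hull_distance M s \<Gamma> h m \<eta> > 0 \<and>
    (\<forall>t. 0 \<le> t \<and> t < ln (p m) / ln (\<rho> m) \<longrightarrow>
       set_integrable \<mu> \<Gamma> (\<lambda>x. Phi t x \<eta>) \<and>
       \<bar>(LINT x:\<Gamma>|\<mu>. Phi t x \<eta>) - singular_rule M \<rho> s p \<Gamma> \<mu> h t m \<eta>\<bar>
         \<le> (real CARD('n) * a_const t * h\<^sup>2 * measure \<mu> \<Gamma>)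
            / (2 * (1 - p m * \<rho> m powr (- t)) * hull_distance M s \<Gamma> h m \<eta> powr (t + 2)))"
proof -
  interpret self_similar_measure M \<rho> s \<Gamma> p \<mu>
  proof
    show "0 < \<rho> l" "\<rho> l < 1" if "l \<in> {1..M}" for l
      using assms(1) that by (auto simp: similarity_ifs_def)
    show "dist (s l x) (s l y) = \<rho> l * dist x y" if "l \<in> {1..M}" for l x y
      using assms(1) that by (rule similarity_ifs_dist)
  qed (rule assms)+
  define c where "c = h / diameter \<Gamma>"
  have "0 < diameter \<Gamma>" using assms(9,10) by linarith
  then have c: "0 < c" "c < 1" using assms(9,10) by (auto simp: c_def)
  have cells: "far_cells c m = {ks \<in> L_index M s \<Gamma> [] h. hd ks \<noteq> m}"
    using L_index_Nil[OF assms(9,10)] by (simp add: far_cells_def c_def)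
  define R where "R = hull_distance M s \<Gamma> h m \<eta>"
  have R_eq: "R = Min ((\<lambda>w. infdist \<eta> (convex hull G w)) ` far_cells c m)"
    by (simp only: R_def hull_distance_def cells)
  have fin: "finite (far_cells c m)"
    using c(1) by (rule finite_far_cells)
  have nonempty: "far_cells c m \<noteq> {}"
  proof -
    have "M \<ge> 2" using assms(1) by (simp add: similarity_ifs_def)
    then obtain l where l: "l \<in> {1..M}" "l \<noteq> m"
      by (intro that[of "if m = 1 then 2 else 1"]) auto
    obtain x where "x \<in> G [l]" using component_nonempty[of "[l]"] by blast
    then obtain w where "w \<in> cut c" "hd w = l"
      using ex_cut_component[OF _ l(1) c] by metis
    then show ?thesis using l(2) by (auto simp: far_cells_def)
  qed
  have "0 < R"
    unfolding R_eq
  proof (subst Min_gr_iff)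
    show "\<forall>d\<in>(\<lambda>w. infdist \<eta> (convex hull G w)) ` far_cells c m. 0 < d"
    proof safe
      fix w assume w: "w \<in> far_cells c m"
      have "compact (convex hull G w)"
        using far_cells_word[OF w] by (intro compact_convex_hull component_compact)
      then show "0 < infdist \<eta> (convex hull G w)"
        using w cells assms(11) component_nonempty
        by (intro infdist_pos_not_in_closed compact_imp_closed) auto
    qed
  qed (use fin nonempty in auto)
  moreover have far: "R \<le> norm (y - \<eta>)" if "w \<in> far_cells c m" "y \<in> convex hull G w" for w y
  proof -
    have "R \<le> infdist \<eta> (convex hull G w)"
      unfolding R_eq using fin that(1) by (intro Min_le) auto
    also have "\<dots> \<le> dist \<eta> y"
      using that(2) by (rule infdist_le)
    finally show ?thesis by (simp add: dist_norm norm_minus_commute)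
  qed
  moreover have "set_integrable \<mu> \<Gamma> (\<lambda>x. Phi t x \<eta>) \<and>
       \<bar>(LINT x:\<Gamma>|\<mu>. Phi t x \<eta>) - singular_rule M \<rho> s p \<Gamma> \<mu> h t m \<eta>\<bar>
         \<le> (real CARD('n) * a_const t * h\<^sup>2 * measure \<mu> \<Gamma>)
            / (2 * (1 - p m * \<rho> m powr (- t)) * R powr (t + 2))"
    if t: "0 \<le> t" "t < ln (p m) / ln (\<rho> m)" for t
  proof -
    have error: "set_integrable \<mu> \<Gamma> (\<lambda>x. Phi t x \<eta>)"
      "\<bar>(LINT x:\<Gamma>|\<mu>. Phi t x \<eta>) - singular_rule M \<rho> s p \<Gamma> \<mu> h t m \<eta>\<bar>
        \<le> (a_const t * h\<^sup>2 * measure \<mu> \<Gamma>) / (2 * (1 - p m * \<rho> m powr (- t)) * R powr (t + 2))"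
      using singular_rule_error[OF assms(5,9,10,6,7) \<open>0 < R\<close> _ t] far by (simp_all only: c_def)
    have "0 < 1 - p m * \<rho> m powr (- t)"
      using integrable_Phi(1)[OF assms(5) c assms(7) _ \<open>0 < R\<close> t] far hull_subset[of _ convex]
      by (metis diff_gt_0_iff_gt subsetD)
    moreover have "0 \<le> a_const t * h\<^sup>2 * measure \<mu> \<Gamma>"
      using t by (simp add: a_const_def)
    then have "1 * (a_const t * h\<^sup>2 * measure \<mu> \<Gamma>) \<le> real CARD('n) * (a_const t * h\<^sup>2 * measure \<mu> \<Gamma>)"
      by (intro mult_right_mono) (simp_all add: Suc_leI)
    ultimately have "(a_const t * h\<^sup>2 * measure \<mu> \<Gamma>) / (2 * (1 - p m * \<rho> m powr (- t)) * R powr (t + 2))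
        \<le> (real CARD('n) * a_const t * h\<^sup>2 * measure \<mu> \<Gamma>)
            / (2 * (1 - p m * \<rho> m powr (- t)) * R powr (t + 2))"
      by (intro divide_right_mono) (simp_all add: mult.assoc)
    with error show ?thesis by (blast intro: order_trans)
  qed
  ultimately show ?thesis
    by (simp add: R_def)
qed

end
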